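(* When the simple graph $G$ is $2$-edge-connected, the critical group $K(\operatorname{line} G)$ can be generated by $\beta(G)$ elements.
   Context: For a graph $G=(V,E)$, $K(G)$ denotes its critical group, the finite abelian group ${\mathbb Z}^E/(B\oplus Z)$ where $B$ and $Z$ are the bond and cycle lattices of $G$; its order is the number of spanning forests. $\beta(G)$ is the number of independent cycles of $G$. $\operatorname{line} G$ denotes the line graph of $G$: its vertex set is $E$, with an edge for each pair of edges of $G$ incident at a vertex. A graph is $2$-edge-connected if it is connected and has no cut-edge. *)

theory Defs
  imports
    "Graph_Theory.Graph_Theory"
    "HOL-Algebra.Free_Abelian_Groups"
    "HOL-Algebra.Generated_Groups"
begin

text \<open>
  A finite simple graph is a digraph satisfying the locale \<open>pair_graph\<close>: every edge \<open>{u, v}\<close> is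
  represented by the two arcs \<open>(u, v)\<close> and \<open>(v, u)\<close>.
\<close>

definition edges :: "'a pair_pre_digraph \<Rightarrow> 'a set set" where
  "edges G = (\<lambda>(u, v). {u, v}) ` parcs G"

definition line_graph :: "'a pair_pre_digraph \<Rightarrow> 'a set pair_pre_digraph" where
  "line_graph G =
    \<lparr> pverts = edges G,
      parcs = {(e, f). e \<in> edges G \<and> f \<in> edges G \<and> e \<noteq> f \<and> e \<inter> f \<noteq> {}} \<rparr>"

definition del_edge :: "'a pair_pre_digraph \<Rightarrow> 'a \<Rightarrow> 'a \<Rightarrow> 'a pair_pre_digraph" where
  "del_edge G u v = \<lparr> pverts = pverts G, parcs = parcs G - {(u, v), (v, u)} \<rparr>"

text \<open>
  On a symmetric digraph the strongly connected components are the connected components of the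
  undirected graph.
\<close>

definition num_components :: "'a pair_pre_digraph \<Rightarrow> nat" where
  "num_components G = card (pre_digraph.sccs_verts (with_proj G))"

definition cut_edge :: "'a pair_pre_digraph \<Rightarrow> 'a \<Rightarrow> 'a \<Rightarrow> bool" where
  "cut_edge G u v \<longleftrightarrow>
    (u, v) \<in> parcs G \<and> num_components G < num_components (del_edge G u v)"

definition two_edge_connected :: "'a pair_pre_digraph \<Rightarrow> bool" where
  "two_edge_connected G \<longleftrightarrow> connected (with_proj G) \<and> (\<nexists>u v. cut_edge G u v)"

text \<open>
  An orientation of \<open>G\<close> keeps exactly one of the two arcs of every edge.  The lattice
  \<open>\<int>\<^sup>E\<close> is then the free abelian group on the arcs of the orientation; the choice of orientation
  only changes the signs of basis vectors.
\<close>

definition orientation :: "'a pair_pre_digraph \<Rightarrow> 'a pair_pre_digraph \<Rightarrow> bool" where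
  "orientation G D \<longleftrightarrow>
    pverts D = pverts G \<and> parcs D \<subseteq> parcs G \<and>
    (\<forall>u v. (u, v) \<in> parcs G \<longrightarrow> ((u, v) \<in> parcs D \<longleftrightarrow> (v, u) \<notin> parcs D))"

definition edge_group :: "'a pair_pre_digraph \<Rightarrow> ('a \<times> 'a \<Rightarrow>\<^sub>0 int) monoid" where
  "edge_group D = free_Abelian_group (parcs D)"

definition vertex_group :: "'a pair_pre_digraph \<Rightarrow> ('a \<Rightarrow>\<^sub>0 int) monoid" where
  "vertex_group D = free_Abelian_group (pverts D)"

definition boundary :: "('a \<times> 'a \<Rightarrow>\<^sub>0 int) \<Rightarrow> ('a \<Rightarrow>\<^sub>0 int)" where
  "boundary = frag_extend (\<lambda>(u, v). frag_of v - frag_of u)"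

text \<open>The transpose of the boundary map: a vertex is sent to the signed sum of its incident arcs.\<close>

definition coboundary :: "'a pair_pre_digraph \<Rightarrow> ('a \<Rightarrow>\<^sub>0 int) \<Rightarrow> ('a \<times> 'a \<Rightarrow>\<^sub>0 int)" where
  "coboundary D = frag_extend (\<lambda>w.
    (\<Sum>a \<in> in_arcs (with_proj D) w. frag_of a) - (\<Sum>a \<in> out_arcs (with_proj D) w. frag_of a))"

definition cycle_lattice :: "'a pair_pre_digraph \<Rightarrow> ('a \<times> 'a \<Rightarrow>\<^sub>0 int) set" where
  "cycle_lattice D = kernel (edge_group D) (vertex_group D) boundary"

definition bond_lattice :: "'a pair_pre_digraph \<Rightarrow> ('a \<times> 'a \<Rightarrow>\<^sub>0 int) set" where
  "bond_lattice D = coboundary D ` carrier (vertex_group D)"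

definition critical_group :: "'a pair_pre_digraph \<Rightarrow> ('a \<times> 'a \<Rightarrow>\<^sub>0 int) set monoid" where
  "critical_group D =
    edge_group D Mod (bond_lattice D <#>\<^bsub>edge_group D\<^esub> cycle_lattice D)"

text \<open>
  The number of independent cycles is the rank of the cycle lattice, i.e. the largest size of a
  family in it that is linearly independent over the integers.
\<close>

definition num_independent_cycles :: "'a pair_pre_digraph \<Rightarrow> nat" (\<open>\<beta>\<close>) where
  "\<beta> D = Max {card S | S. S \<subseteq> cycle_lattice D \<and> finite S \<and> \<not> module.dependent frag_cmul S}"

end

theory Submission
  imports Defs
begin

text \<open>
  The boundary map turns \<open>K(line G)\<close> into a quotient of the group of degree-zero combinations of edges
  of \<open>G\<close>: the relation belonging to an edge \<open>e = uv\<close> reads \<open>(d(u) + d(v)) e = s(u) + s(v)\<close>, where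
  \<open>s(u)\<close> is the sum of the edges at \<open>u\<close>.  Consequently, in any further quotient, \<open>x(e) = 0\<close> and
  \<open>s(u) = 0\<close> force \<open>s(v) = 0\<close>; and \<open>s(u) = 0\<close> together with the vanishing of all edges at \<open>u\<close> but
  one forces the last one to vanish.

  Playing this zero forcing game, 2-edge-connectedness yields a spanning tree \<open>T\<close> and a vertex \<open>r\<close> such
  that the vanishing of \<open>s(r)\<close> and of the \<open>\<beta>(G)\<close> chords of \<open>T\<close> implies that all edges vanish.  Fixing a
  chord \<open>c\<close> and taking \<open>x(e) = e - c\<close>, the chord \<open>c\<close> itself is free of charge, so the classes of
  \<open>f - c\<close> for the remaining \<open>\<beta>(G) - 1\<close> chords and of \<open>s(r) - d(r) c\<close> generate the critical group.
\<close>

section \<open>Zero forcing along a spanning tree\<close>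

text \<open>These are the subgroups of the additive group of a type. Membership in \<open>N\<close>
  stands for vanishing in the quotient by \<open>N\<close>, so the game can be played without
  forming quotients.\<close>

definition int_subspace :: "'b::ab_group_add set \<Rightarrow> bool" where
  "int_subspace N \<longleftrightarrow> 0 \<in> N \<and> (\<forall>a\<in>N. \<forall>b\<in>N. a - b \<in> N)"

lemma int_subspace_add:
  assumes "int_subspace N" "a \<in> N" "b \<in> N"
  shows "a + b \<in> N"
proof -
  have "0 - b \<in> N" using assms unfolding int_subspace_def by blast
  then have "a - (0 - b) \<in> N" using assms unfolding int_subspace_def by blast
  then show ?thesis by simp
qed

lemma int_subspace_diff: "int_subspace N \<Longrightarrow> a \<in> N \<Longrightarrow> b \<in> N \<Longrightarrow> a - b \<in> N"
  unfolding int_subspace_def by blast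

lemma int_subspace_sum:
  assumes "int_subspace N" "\<And>i. i \<in> I \<Longrightarrow> f i \<in> N"
  shows "sum f I \<in> N"
  using assms(2)
  by (induction I rule: infinite_finite_induct)
     (use assms(1) in \<open>auto simp: int_subspace_add int_subspace_def[THEN iffD1, THEN conjunct1]\<close>)

section \<open>Edge labellings and the rules of the game\<close>

locale finite_sym_rel =
  fixes E :: "('a \<times> 'a) set"
  assumes finite_E: "finite E"
    and sym_E: "(u, v) \<in> E \<Longrightarrow> (v, u) \<in> E"
begin

definition star_sum :: "('a set \<Rightarrow> 'b::ab_group_add) \<Rightarrow> 'a \<Rightarrow> 'b" where
  "star_sum x u = (\<Sum>v\<in>E `` {u}. x {u, v})"

text \<open>The first rule of the game. It is all that the tree construction has to know of the
  relation belonging to an edge.\<close>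

definition propagates :: "'b::ab_group_add set \<Rightarrow> ('a set \<Rightarrow> 'b) \<Rightarrow> bool" where
  "propagates N x \<longleftrightarrow>
    (\<forall>u v. (u, v) \<in> E \<longrightarrow> x {u, v} \<in> N \<longrightarrow> star_sum x u \<in> N \<longrightarrow> star_sum x v \<in> N)"

text \<open>
  Read \<open>A\<close> as the vertices of \<open>C\<close> whose star sums are already known to vanish and \<open>r\<close> as the root of the
  tree to be built.  The condition says that \<open>C\<close> is connected and that, after joining an outside
  vertex to all of \<open>A \<union> {r}\<close>, no single edge separates a vertex set avoiding \<open>r\<close>.  This form, unlike 2-edge-connectedness of \<open>C\<close>
  itself, survives the removal of vertices.
\<close>

definition seeded :: "'a set \<Rightarrow> 'a set \<Rightarrow> 'a \<Rightarrow> bool" where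
  "seeded C A r \<longleftrightarrow> finite C \<and> r \<in> C \<and> A \<subseteq> C \<and> A \<noteq> {} \<and>
    (\<forall>X. X \<subseteq> C - {r} \<longrightarrow> X \<noteq> {} \<longrightarrow> (\<exists>p. p \<in> E \<inter> X \<times> (C - X)) \<and>
      (X \<inter> A = {} \<longrightarrow> (\<exists>p q. p \<in> E \<inter> X \<times> (C - X) \<and> q \<in> E \<inter> X \<times> (C - X) \<and> p \<noteq> q)))"

text \<open>
  Edges leaving \<open>C\<close> at \<open>r\<close> are exempt from the second hypothesis, so no edge may be forced from the
  star sum at \<open>r\<close>; the exempt edges are settled afterwards, when \<open>C\<close> is glued to the rest at \<open>r\<close>.
\<close>

definition forced :: "'a set \<Rightarrow> 'a set \<Rightarrow> 'a \<Rightarrow> 'a set set \<Rightarrow> 'b::ab_group_add set \<Rightarrow> ('a set \<Rightarrow> 'b) \<Rightarrow> bool" where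
  "forced C A r T N x \<longleftrightarrow>
    (\<forall>u\<in>C. \<forall>v\<in>C. (u, v) \<in> E \<longrightarrow> {u, v} \<notin> T \<longrightarrow> x {u, v} \<in> N) \<longrightarrow>
    (\<forall>u\<in>C - {r}. \<forall>v. (u, v) \<in> E \<longrightarrow> v \<notin> C \<longrightarrow> x {u, v} \<in> N) \<longrightarrow>
    (\<forall>a\<in>A. star_sum x a \<in> N) \<longrightarrow>
    (\<forall>u\<in>C. \<forall>v\<in>C. (u, v) \<in> E \<longrightarrow> x {u, v} \<in> N) \<and> (\<forall>v\<in>C. star_sum x v \<in> N)"

text \<open>A connected graph with one vertex more than edges is a tree, so acyclicity follows from
  the count.\<close>

definition forcing_tree :: "'a set \<Rightarrow> 'a \<Rightarrow> 'a set set \<Rightarrow> bool" where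
  "forcing_tree C r T \<longleftrightarrow> T \<subseteq> {{u, v} | u v. u \<in> C \<and> v \<in> C \<and> (u, v) \<in> E} \<and>
    card T + 1 = card C \<and> (\<forall>u\<in>C. (u, r) \<in> {(v, w). {v, w} \<in> T}\<^sup>*)"

lemma finite_nbrs: "finite (E `` {u})"
  using finite_E by (simp add: finite_Image)

text \<open>The second rule of the game: the star sum minus all other labels at \<open>u\<close> is
  the last label.\<close>

lemma last_edge_mem:
  assumes N: "int_subspace N" and "star_sum x u \<in> N" "(u, v) \<in> E"
    and oth: "\<And>w. (u, w) \<in> E \<Longrightarrow> w \<noteq> v \<Longrightarrow> x {u, w} \<in> N"
  shows "x {u, v} \<in> N"
proof -
  have "star_sum x u = x {u, v} + (\<Sum>w\<in>E `` {u} - {v}. x {u, w})"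
    unfolding star_sum_def using assms(3) finite_nbrs by (subst sum.remove[of _ v]) auto
  moreover have "(\<Sum>w\<in>E `` {u} - {v}. x {u, w}) \<in> N"
    by (rule int_subspace_sum[OF N]) (use oth in auto)
  ultimately have "star_sum x u - (\<Sum>w\<in>E `` {u} - {v}. x {u, w}) \<in> N"
    using assms(2) int_subspace_diff[OF N] by blast
  then show ?thesis using \<open>star_sum x u = _\<close> by simp
qed

lemma propagatesD:
  "propagates N x \<Longrightarrow> (u, v) \<in> E \<Longrightarrow> x {u, v} \<in> N \<Longrightarrow> star_sum x u \<in> N \<Longrightarrow> star_sum x v \<in> N"
  unfolding propagates_def by blast

lemma forcedD:
  assumes "forced C A r T N x"
    and "\<And>u v. u \<in> C \<Longrightarrow> v \<in> C \<Longrightarrow> (u, v) \<in> E \<Longrightarrow> {u, v} \<notin> T \<Longrightarrow> x {u, v} \<in> N"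
    and "\<And>u v. u \<in> C \<Longrightarrow> u \<noteq> r \<Longrightarrow> (u, v) \<in> E \<Longrightarrow> v \<notin> C \<Longrightarrow> x {u, v} \<in> N"
    and "\<And>a. a \<in> A \<Longrightarrow> star_sum x a \<in> N"
  shows "u \<in> C \<Longrightarrow> v \<in> C \<Longrightarrow> (u, v) \<in> E \<Longrightarrow> x {u, v} \<in> N" "v \<in> C \<Longrightarrow> star_sum x v \<in> N"
  using assms unfolding forced_def by simp_all

lemma seeded_cross:
  assumes "seeded C A r" "X \<subseteq> C - {r}" "X \<noteq> {}"
  shows "\<exists>u v. (u, v) \<in> E \<and> u \<in> X \<and> v \<in> C \<and> v \<notin> X"
proof -
  have "\<exists>p. p \<in> E \<inter> X \<times> (C - X)" using assms unfolding seeded_def by simp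
  then show ?thesis by blast
qed

lemma seeded_cross2:
  assumes "seeded C A r" "X \<subseteq> C - {r}" "X \<noteq> {}" "X \<inter> A = {}"
  shows "\<exists>u v u' v'. (u, v) \<in> E \<and> u \<in> X \<and> v \<in> C \<and> v \<notin> X \<and>
    (u', v') \<in> E \<and> u' \<in> X \<and> v' \<in> C \<and> v' \<notin> X \<and> (u, v) \<noteq> (u', v')"
proof -
  have "\<exists>p q. p \<in> E \<inter> X \<times> (C - X) \<and> q \<in> E \<inter> X \<times> (C - X) \<and> p \<noteq> q"
    using assms unfolding seeded_def by simp
  then obtain p q where "p \<in> E \<inter> X \<times> (C - X)" "q \<in> E \<inter> X \<times> (C - X)" "p \<noteq> q" by blast
  then show ?thesis by (cases p; cases q) blast
qed

lemma seededI:
  assumes "finite C" "r \<in> C" "A \<subseteq> C" "A \<noteq> {}"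
   "\<And>X. X \<subseteq> C - {r} \<Longrightarrow> X \<noteq> {} \<Longrightarrow> \<exists>u v. (u, v) \<in> E \<and> u \<in> X \<and> v \<in> C \<and> v \<notin> X"
   "\<And>X. X \<subseteq> C - {r} \<Longrightarrow> X \<noteq> {} \<Longrightarrow> X \<inter> A = {} \<Longrightarrow>
   \<exists>u v u' v'. (u, v) \<in> E \<and> u \<in> X \<and> v \<in> C \<and> v \<notin> X \<and> (u', v') \<in> E \<and> u' \<in> X \<and> v' \<in> C \<and> v' \<notin> X \<and> (u, v) \<noteq> (u', v')"
  shows "seeded C A r"
  unfolding seeded_def using assms(1-4)
proof (intro conjI allI impI)
  fix X assume X: "X \<subseteq> C - {r}" "X \<noteq> {}"
  from assms(5)[OF this] show "\<exists>p. p \<in> E \<inter> X \<times> (C - X)" by blast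
  assume "X \<inter> A = {}"
  from assms(6)[OF X this] show "\<exists>p q. p \<in> E \<inter> X \<times> (C - X) \<and> q \<in> E \<inter> X \<times> (C - X) \<and> p \<noteq> q" by blast
qed auto

lemma forcing_tree_mono: "(u, r) \<in> {(v, w). {v, w} \<in> T}\<^sup>* \<Longrightarrow> T \<subseteq> T' \<Longrightarrow> (u, r) \<in> {(v, w). {v, w} \<in> T'}\<^sup>*"
  by (erule rev_subsetD, rule rtrancl_mono) auto

lemma forcing_tree_finite: "forcing_tree C r T \<Longrightarrow> finite C \<Longrightarrow> finite T"
proof -
  assume "forcing_tree C r T" "finite C"
  then have "T \<subseteq> (\<lambda>(u, v). {u, v}) ` E" unfolding forcing_tree_def by auto
  then show ?thesis using finite_E finite_subset by blast
qed

text \<open>For \<open>a\<close> different from \<open>r\<close>, this says that deleting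
  \<open>a\<close> leaves \<open>C\<close> connected: every part without the root still has an edge
  to the rest.\<close>

definition linked :: "'a set \<Rightarrow> 'a \<Rightarrow> 'a \<Rightarrow> bool" where
  "linked C r a \<longleftrightarrow> (\<forall>X. X \<subseteq> C - {a} - {r} \<longrightarrow> X \<noteq> {} \<longrightarrow>
    (\<exists>u\<in>X. \<exists>v\<in>C - {a}. (u, v) \<in> E \<and> v \<notin> X))"

text \<open>A set without any of the new seeds has no edge to \<open>a\<close>, so the two edges
  leaving it stay inside \<open>C - {a}\<close>.\<close>

lemma seeded_remove_seed:
  assumes S: "seeded C A r" and a: "a \<in> A" "a \<noteq> r"
    and conn: "linked C r a"
    and b: "b \<in> C" "(a, b) \<in> E" "b \<noteq> a"
  shows "seeded (C - {a}) (A - {a} \<union> (E `` {a} \<inter> (C - {a}))) r"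
proof (rule seededI)
  have "finite C" "r \<in> C" "A \<subseteq> C" using S unfolding seeded_def by auto
  then show "finite (C - {a})" "r \<in> C - {a}" "A - {a} \<union> (E `` {a} \<inter> (C - {a})) \<subseteq> C - {a}" using a by auto
  show "A - {a} \<union> (E `` {a} \<inter> (C - {a})) \<noteq> {}" using b by auto
  fix X assume X: "X \<subseteq> C - {a} - {r}" "X \<noteq> {}"
  show "\<exists>u v. (u, v) \<in> E \<and> u \<in> X \<and> v \<in> C - {a} \<and> v \<notin> X"
    using conn X unfolding linked_def by blast
  assume "X \<inter> (A - {a} \<union> (E `` {a} \<inter> (C - {a}))) = {}"
  then have "X \<inter> A = {}" and na: "\<And>u. u \<in> X \<Longrightarrow> (u, a) \<notin> E" using X sym_E by blast+
  from seeded_cross2[OF S _ X(2) this(1)] X obtain u v u' v' where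
   "(u, v) \<in> E \<and> u \<in> X \<and> v \<in> C \<and> v \<notin> X \<and> (u', v') \<in> E \<and> u' \<in> X \<and> v' \<in> C \<and> v' \<notin> X \<and> (u, v) \<noteq> (u', v')" by blast
  then show "\<exists>u v u' v'. (u, v) \<in> E \<and> u \<in> X \<and> v \<in> C - {a} \<and> v \<notin> X \<and> (u', v') \<in> E \<and> u' \<in> X \<and> v' \<in> C - {a} \<and> v' \<notin> X \<and> (u, v) \<noteq> (u', v')"
    using na by blast
qed

text \<open>All edges at \<open>a\<close> except \<open>{a, b}\<close> are chords or leave
  \<open>C\<close>, so the star sum at \<open>a\<close> forces \<open>{a, b}\<close>. Then
  \<open>a\<close> passes its vanishing star sum on to its neighbours, and every edge from
  \<open>C - {a}\<close> to \<open>a\<close> is known.\<close>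

lemma forced_remove_seed:
  assumes N: "int_subspace N" and P: "propagates N x"
    and F: "forced (C - {a}) (A - {a} \<union> (E `` {a} \<inter> (C - {a}))) r T N x"
    and T: "\<Union>T \<subseteq> C - {a}" and a: "a \<in> A" "a \<noteq> r" "a \<in> C" and b: "b \<in> C" "(a, b) \<in> E" "b \<noteq> a"
  shows "forced C A r (insert {a, b} T) N x"
  unfolding forced_def
proof (intro impI)
  assume 1: "\<forall>u\<in>C. \<forall>v\<in>C. (u, v) \<in> E \<longrightarrow> {u, v} \<notin> insert {a, b} T \<longrightarrow> x {u, v} \<in> N"
    and 2: "\<forall>u\<in>C - {r}. \<forall>v. (u, v) \<in> E \<longrightarrow> v \<notin> C \<longrightarrow> x {u, v} \<in> N"
    and 3: "\<forall>a\<in>A. star_sum x a \<in> N"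
  have oth: "x {a, w} \<in> N" if "(a, w) \<in> E" "w \<noteq> b" for w
  proof (cases "w \<in> C")
    case True
    have "{a, w} \<notin> insert {a, b} T" using that T by (auto simp: doubleton_eq_iff)
    then show ?thesis using 1 that a True by blast
  qed (use 2 a that in blast)
  have ab: "x {a, b} \<in> N" by (rule last_edge_mem[OF N]) (use a b 3 oth in auto)
  have aw: "x {a, w} \<in> N" if "(a, w) \<in> E" for w using ab oth that by blast
  have "x {u, v} \<in> N" if "u \<in> C - {a}" "v \<in> C - {a}" "(u, v) \<in> E" "{u, v} \<notin> T" for u v
  proof -
    have "{u, v} \<noteq> {a, b}" using that by (auto simp: doubleton_eq_iff)
    then show ?thesis using 1 that by auto
  qed
  moreover have "x {u, v} \<in> N" if "u \<in> C - {a} - {r}" "(u, v) \<in> E" "v \<notin> C - {a}" for u v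
  proof (cases "v = a")
    case True then show ?thesis using aw[of u] sym_E that by (auto simp: insert_commute)
  qed (use that 2 in auto)
  moreover have "star_sum x w \<in> N" if "w \<in> A - {a} \<union> (E `` {a} \<inter> (C - {a}))" for w
    using that 3 propagatesD[OF P, of a w] aw a by auto
  ultimately have R: "(\<forall>u\<in>C-{a}. \<forall>v\<in>C-{a}. (u, v) \<in> E \<longrightarrow> x {u, v} \<in> N)" "(\<forall>v\<in>C-{a}. star_sum x v \<in> N)"
    using F unfolding forced_def by blast+
  have "x {u, v} \<in> N" if "u \<in> C" "v \<in> C" "(u, v) \<in> E" for u v
    using that R(1) aw[of u] aw[of v] sym_E by (cases "u = a"; cases "v = a") (auto simp: insert_commute)
  moreover have "star_sum x v \<in> N" if "v \<in> C" for v using R(2) 3 a that by (cases "v = a") auto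
  ultimately show "(\<forall>u\<in>C. \<forall>v\<in>C. (u, v) \<in> E \<longrightarrow> x {u, v} \<in> N) \<and> (\<forall>v\<in>C. star_sum x v \<in> N)" by blast
qed

text \<open>The edges from \<open>a\<close> into \<open>D\<close> other than \<open>{a, b}\<close>
  are chords, so they turn their ends in \<open>D\<close> into seeds. Once \<open>D\<close> is
  settled, the star sum at \<open>b\<close> forces \<open>{a, b}\<close>, and then
  \<open>C - D\<close> has only vanishing edges into \<open>D\<close>.\<close>

lemma forced_glue:
  assumes N: "int_subspace N" and P: "propagates N x"
    and FD: "forced D (E `` {a} \<inter> D - {b}) b TD N x"
    and FC: "forced (C - D) A r TC N x"
    and T: "\<Union>TD \<subseteq> D" "\<Union>TC \<subseteq> C - D" 
    and D: "D \<subseteq> C - {a, r}" "\<And>u v. (u, v) \<in> E \<Longrightarrow> u \<in> D \<Longrightarrow> v \<in> C \<Longrightarrow> v \<in> D \<or> v = a"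
    and a: "a \<in> A" "A \<subseteq> C - D" and b: "b \<in> D" "(a, b) \<in> E"
  shows "forced C A r (insert {a, b} (TD \<union> TC)) N x"
  unfolding forced_def
proof (intro impI)
  let ?T = "insert {a, b} (TD \<union> TC)"
  assume 1: "\<forall>u\<in>C. \<forall>v\<in>C. (u, v) \<in> E \<longrightarrow> {u, v} \<notin> ?T \<longrightarrow> x {u, v} \<in> N"
    and 2: "\<forall>u\<in>C - {r}. \<forall>v. (u, v) \<in> E \<longrightarrow> v \<notin> C \<longrightarrow> x {u, v} \<in> N"
    and 3: "\<forall>a\<in>A. star_sum x a \<in> N"
  have aD: "a \<notin> D" "a \<in> C" "D \<subseteq> C" "r \<notin> D" using a D(1) by auto
  have aw: "x {a, w} \<in> N" if "(a, w) \<in> E" "w \<in> D" "w \<noteq> b" for w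
  proof -
    have "{a, w} \<notin> ?T" using that T aD by (auto simp: doubleton_eq_iff)
    then show ?thesis using 1 that a aD by blast
  qed
  \<comment> \<open>The only edge leaving \<open>D\<close> that is still open is the one from
    \<open>b\<close> to \<open>a\<close>, which is exempt because \<open>b\<close> is the root of
    \<open>D\<close>.\<close>
  have out: "x {u, v} \<in> N" if "u \<in> D" "(u, v) \<in> E" "v \<notin> D" "u \<noteq> b \<or> v \<noteq> a" for u v
  proof (cases "v \<in> C")
    case True
    then have "v = a" using that D(2)[of u v] by auto
    then show ?thesis using aw[of u] that sym_E[of u a] by (auto simp: insert_commute)
  qed (use 2 that aD in blast)
  have "x {u, v} \<in> N" if "u \<in> D" "v \<in> D" "(u, v) \<in> E" "{u, v} \<notin> TD" for u v
  proof -
    have "{u, v} \<notin> ?T" using that T(2) aD by (auto simp: doubleton_eq_iff)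
    then show ?thesis using 1 that aD by blast
  qed
  moreover have "star_sum x w \<in> N" if "w \<in> E `` {a} \<inter> D - {b}" for w
    using that 3 a propagatesD[OF P, of a w] aw by auto
  ultimately have RD: "\<And>u v. u \<in> D \<Longrightarrow> v \<in> D \<Longrightarrow> (u, v) \<in> E \<Longrightarrow> x {u, v} \<in> N" "\<And>v. v \<in> D \<Longrightarrow> star_sum x v \<in> N"
    using FD out unfolding forced_def by blast+
  have "x {b, a} \<in> N"
  proof (rule last_edge_mem[OF N])
    show "x {b, w} \<in> N" if "(b, w) \<in> E" "w \<noteq> a" for w
      using RD(1) out that b by blast
  qed (use RD b sym_E in auto)
  then have Dv: "x {u, v} \<in> N" if "u \<in> D" "(u, v) \<in> E" for u v
    using out RD(1) that by blast
  have "x {u, v} \<in> N" if "u \<in> C - D" "v \<in> C - D" "(u, v) \<in> E" "{u, v} \<notin> TC" for u v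
  proof -
    have "{u, v} \<notin> ?T" using that T(1) aD b by (auto simp: doubleton_eq_iff)
    then show ?thesis using 1 that aD by blast
  qed
  moreover have "x {u, v} \<in> N" if "u \<in> C - D - {r}" "(u, v) \<in> E" "v \<notin> C - D" for u v
    using that 2 Dv[of v u] sym_E[of u v] by (cases "v \<in> D") (auto simp: insert_commute)
  ultimately have RC: "\<And>u v. u \<in> C - D \<Longrightarrow> v \<in> C - D \<Longrightarrow> (u, v) \<in> E \<Longrightarrow> x {u, v} \<in> N"
     "\<And>v. v \<in> C - D \<Longrightarrow> star_sum x v \<in> N"
    using FC 3 unfolding forced_def by blast+
  have "x {u, v} \<in> N" if "u \<in> C" "v \<in> C" "(u, v) \<in> E" for u v
    using that RC(1) Dv[of u v] Dv[of v u] sym_E[of u v] by (cases "u \<in> D"; cases "v \<in> D") (auto simp: insert_commute)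
  then show "(\<forall>u\<in>C. \<forall>v\<in>C. (u, v) \<in> E \<longrightarrow> x {u, v} \<in> N) \<and> (\<forall>v\<in>C. star_sum x v \<in> N)"
    using RC(2) RD(2) by blast
qed

text \<open>Such a \<open>D\<close> is a nonempty union of components of \<open>C - {a}\<close> that
  miss the root; \<open>a = r\<close> is allowed.\<close>

definition lobe :: "'a set \<Rightarrow> 'a \<Rightarrow> 'a \<Rightarrow> 'a set \<Rightarrow> bool" where
  "lobe C r a D \<longleftrightarrow> D \<noteq> {} \<and> D \<subseteq> C - {a, r} \<and> (\<forall>u\<in>D. \<forall>v\<in>C. (u, v) \<in> E \<longrightarrow> v \<in> D \<or> v = a)"

text \<open>The minimum is taken over the lobes of all seeds together. A seed inside the minimal
  \<open>D\<close> would be a cut vertex and would cut off a smaller lobe within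
  \<open>D\<close>.\<close>

lemma minimal_lobe:
  assumes S: "seeded C A r" and "card C \<noteq> 1"
    and cut: "\<And>a. a \<in> A \<Longrightarrow> a \<noteq> r \<Longrightarrow> \<not> linked C r a"
  shows "\<exists>a D. a \<in> A \<and> lobe C r a D \<and> D \<inter> A = {} \<and> (\<forall>X. lobe C r a X \<longrightarrow> card D \<le> card X)"
proof -
  have fin: "finite C" "r \<in> C" "A \<subseteq> C" "A \<noteq> {}" using S unfolding seeded_def by auto
  have ex: "\<exists>D. lobe C r a D" if a: "a \<in> A" for a
  \<comment> \<open>The hypothesis on cut vertices says nothing about the root, but all of
    \<open>C - {r}\<close> is a lobe at \<open>r\<close>.\<close>
  proof (cases "a = r")
    case True
    have "C - {r} \<noteq> {}" using fin \<open>card C \<noteq> 1\<close> by (metis card_1_singleton_iff Diff_eq_empty_iff empty_iff subset_singletonD One_nat_def)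
    then have "lobe C r a (C - {r})" using True unfolding lobe_def by auto
    then show ?thesis by blast
  next
    case False
    from cut[OF a False] obtain X where "X \<subseteq> C - {a} - {r} \<and> X \<noteq> {} \<and> (\<forall>u\<in>X. \<forall>v\<in>C - {a}. (u, v) \<in> E \<longrightarrow> v \<in> X)"
      unfolding linked_def by blast
    then have "lobe C r a X" unfolding lobe_def by auto
    then show ?thesis by blast
  qed
  define P where "P = (\<lambda>(a, D). a \<in> A \<and> lobe C r a D)"
  have "\<exists>p. P p" using ex fin(4) unfolding P_def by auto
  then obtain p where p: "P p" "\<And>q. P q \<Longrightarrow> card (snd p) \<le> card (snd q)"
    using ex_has_least_nat[of P _ "\<lambda>p. card (snd p)"] by blast
  obtain a D where "p = (a, D)" by force
  with p have aD: "a \<in> A" "lobe C r a D" and min: "\<And>a' X. a' \<in> A \<Longrightarrow> lobe C r a' X \<Longrightarrow> card D \<le> card X"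
    unfolding P_def by auto
  have finD: "finite D" using aD(2) fin unfolding lobe_def by (meson finite_Diff finite_subset)
  have Dout: "v \<in> D \<or> v = a" if "u \<in> D" "v \<in> C" "(u, v) \<in> E" for u v using aD(2) that unfolding lobe_def by blast
  have Dsub: "a \<notin> D" "r \<notin> D" "D \<subseteq> C" using aD(2) unfolding lobe_def by auto
  have "D \<inter> A = {}"
  proof (rule ccontr)
    assume "D \<inter> A \<noteq> {}"
    then obtain a' where a': "a' \<in> D" "a' \<in> A" by blast
    then have "a' \<noteq> r" using Dsub by auto
    from cut[OF a'(2) this] obtain X where X: "X \<subseteq> C - {a'} - {r}" "X \<noteq> {}"
      "\<And>u v. u \<in> X \<Longrightarrow> v \<in> C \<Longrightarrow> v \<noteq> a' \<Longrightarrow> (u, v) \<in> E \<Longrightarrow> v \<in> X"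
      unfolding linked_def by blast
    have smaller: False if "lobe C r a' Y" "Y \<subseteq> D" "a' \<notin> Y" for Y
    proof -
      have "card Y < card D" using that finD a' by (intro psubset_card_mono) auto
      then show False using min[OF a'(2) that(1)] by auto
    qed
    show False
    \<comment> \<open>The set \<open>X\<close> is closed within \<open>C - {a'}\<close>. If it
      misses \<open>a\<close>, then \<open>X \<inter> D\<close> is a lobe at \<open>a'\<close>; if
      it contains \<open>a\<close>, then \<open>D - X - {a'}\<close> is one. Both are smaller than
      \<open>D\<close>, and connectedness of \<open>C\<close> keeps them from being empty.\<close>
    proof (cases "a \<in> X")
      case False
      show False
      proof (cases "X \<inter> D = {}")
        case True
        obtain u v where "(u, v) \<in> E" "u \<in> X" "v \<in> C" "v \<notin> X"
          using seeded_cross[OF S, of X] X by blast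
        moreover from this have "v = a'" using X(3) by blast
        ultimately show False using Dout[of v u] a' sym_E X(1) True False by blast
      next
        case F: False
        have "lobe C r a' (X \<inter> D)" unfolding lobe_def
          using F X Dsub Dout False by blast
        then show False using smaller X by blast
      qed
    next
      case True
      show False
      proof (cases "D - X - {a'} = {}")
        case True': True
        have "X \<union> {a'} \<subseteq> C - {r}" using X a' Dsub by auto
        then obtain u v where uv: "(u, v) \<in> E" "u \<in> X \<union> {a'}" "v \<in> C" "v \<notin> X" "v \<noteq> a'"
          using seeded_cross[OF S, of "X \<union> {a'}"] by blast
        then have "u = a'" using X(3) by blast
        then show False using uv Dout[of u v] a' True True' by blast
      next
        case F: False
        have "v \<in> D - X - {a'} \<or> v = a'" if "u \<in> D - X - {a'}" "v \<in> C" "(u, v) \<in> E" for u v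
          using that X(3)[of v u] sym_E[of u v] Dout[of u v] Dsub True by blast
        then have "lobe C r a' (D - X - {a'})" unfolding lobe_def
          using F Dsub by blast
        then show False using smaller by blast
      qed
    qed
  qed
  with aD min show ?thesis by blast
qed

text \<open>As \<open>D\<close> has no seeds, at least two edges join it to \<open>a\<close>: one
  provides the root \<open>b\<close>, another a seed. Moreover \<open>D\<close> is connected,
  because a closed part without \<open>b\<close> would be a smaller lobe.\<close>

lemma seeded_lobe:
  assumes S: "seeded C A r" and a: "a \<in> A" and L: "lobe C r a D" and DA: "D \<inter> A = {}"
    and min: "\<forall>X. lobe C r a X \<longrightarrow> card D \<le> card X"
  shows "\<exists>b. b \<in> D \<and> (a, b) \<in> E \<and> seeded D (E `` {a} \<inter> D - {b}) b"
proof -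
  have fin: "finite C" "r \<in> C" "A \<subseteq> C" "A \<noteq> {}" using S unfolding seeded_def by auto
  have Dout: "v \<in> D \<or> v = a" if "u \<in> D" "v \<in> C" "(u, v) \<in> E" for u v using L that unfolding lobe_def by blast
  have Dsub: "a \<notin> D" "r \<notin> D" "D \<subseteq> C" "D \<noteq> {}" using L unfolding lobe_def by auto
  have finD: "finite D" using Dsub fin finite_subset by blast
  obtain u v u' v' where "(u, v) \<in> E" "u \<in> D" "v \<in> C" "v \<notin> D" "(u', v') \<in> E" "u' \<in> D" "v' \<in> C" "v' \<notin> D" "(u, v) \<noteq> (u', v')"
    using seeded_cross2[OF S _ Dsub(4) DA] Dsub by blast
  moreover from this have "v = a" "v' = a" using Dout by blast+
  ultimately have b: "u \<in> D" "(a, u) \<in> E" "u' \<in> D" "(a, u') \<in> E" "u' \<noteq> u" using sym_E by blast+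
  have cr: "\<exists>w v. (w, v) \<in> E \<and> w \<in> X \<and> v \<in> D \<and> v \<notin> X" if X: "X \<subseteq> D - {u}" "X \<noteq> {}" for X
  proof (rule ccontr)
    assume n: "\<nexists>w v. (w, v) \<in> E \<and> w \<in> X \<and> v \<in> D \<and> v \<notin> X"
    then have "lobe C r a X" unfolding lobe_def using X Dsub Dout by blast
    moreover have "card X < card D" using X b finD by (intro psubset_card_mono) auto
    ultimately show False using min by fastforce
  qed
  have "seeded D (E `` {a} \<inter> D - {u}) u"
  proof (rule seededI)
    fix X assume X: "X \<subseteq> D - {u}" "X \<noteq> {}" and XA: "X \<inter> (E `` {a} \<inter> D - {u}) = {}"
    then have "\<And>w. w \<in> X \<Longrightarrow> (w, a) \<notin> E" using sym_E by blast
    then have q: "v \<in> D" if "(w, v) \<in> E" "w \<in> X" "v \<in> C" for w v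
      using that Dout[of w v] X(1) by blast
    have "X \<inter> A = {}" "X \<subseteq> C - {r}" using X DA Dsub by auto
    from seeded_cross2[OF S this(2) X(2) this(1)] obtain w1 v1 w2 v2 where
      "(w1, v1) \<in> E" "w1 \<in> X" "v1 \<in> C" "v1 \<notin> X" "(w2, v2) \<in> E" "w2 \<in> X" "v2 \<in> C" "v2 \<notin> X" "(w1, v1) \<noteq> (w2, v2)" by blast
    then show "\<exists>u v u' v'. (u, v) \<in> E \<and> u \<in> X \<and> v \<in> D \<and> v \<notin> X \<and> (u', v') \<in> E \<and> u' \<in> X \<and> v' \<in> D \<and> v' \<notin> X \<and> (u, v) \<noteq> (u', v')"
      using q by blast
  qed (use b finD cr in auto)
  with b(1,2) show ?thesis by blast
qed

text \<open>If \<open>X\<close> contains \<open>a\<close>, then an edge leaving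
  \<open>X \<union> D\<close> starts in \<open>X\<close>, because \<open>D\<close> borders only on
  \<open>a\<close>. Otherwise \<open>X\<close> has no edge into \<open>D\<close>; sets without seeds
  are of this second kind.\<close>

lemma seeded_remove_lobe:
  assumes S: "seeded C A r" and a: "a \<in> A" and L: "lobe C r a D" and DA: "D \<inter> A = {}"
  shows "seeded (C - D) A r"
proof -
  have fin: "finite C" "r \<in> C" "A \<subseteq> C" "A \<noteq> {}" using S unfolding seeded_def by auto
  have Dout: "v \<in> D \<or> v = a" if "u \<in> D" "v \<in> C" "(u, v) \<in> E" for u v using L that unfolding lobe_def by blast
  have Dsub: "a \<notin> D" "r \<notin> D" "D \<subseteq> C" "D \<noteq> {}" using L unfolding lobe_def by auto
  have noD: "v \<notin> D" if "a \<notin> X" "X \<subseteq> C - D - {r}" "u \<in> X" "(u, v) \<in> E" for X u v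
    using Dout[of v u] sym_E that by blast
  show ?thesis
  proof (rule seededI)
    fix X assume X: "X \<subseteq> C - D - {r}" "X \<noteq> {}"
    show "\<exists>u v. (u, v) \<in> E \<and> u \<in> X \<and> v \<in> C - D \<and> v \<notin> X"
    proof (cases "a \<in> X")
      case True
      have "X \<union> D \<subseteq> C - {r}" "X \<union> D \<noteq> {}" using X Dsub by auto
      from seeded_cross[OF S this] show ?thesis using Dout True by blast
    next
      case False
      have "X \<subseteq> C - {r}" using X by auto
      from seeded_cross[OF S this X(2)] show ?thesis using noD[OF False X(1)] by blast
    qed
    assume XA: "X \<inter> A = {}"
    then have aX: "a \<notin> X" using a by blast
    have "X \<subseteq> C - {r}" using X by auto
    from seeded_cross2[OF S this X(2) XA] obtain w1 v1 w2 v2 where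
      "(w1, v1) \<in> E" "w1 \<in> X" "v1 \<in> C" "v1 \<notin> X" "(w2, v2) \<in> E" "w2 \<in> X" "v2 \<in> C" "v2 \<notin> X" "(w1, v1) \<noteq> (w2, v2)" by blast
    then show "\<exists>u v u' v'. (u, v) \<in> E \<and> u \<in> X \<and> v \<in> C - D \<and> v \<notin> X \<and> (u', v') \<in> E \<and> u' \<in> X \<and> v' \<in> C - D \<and> v' \<notin> X \<and> (u, v) \<noteq> (u', v')"
      using noD[OF aX X(1)] by blast
  qed (use fin Dsub DA in auto)
qed

text \<open>
  If some seed other than the root is not a cut vertex, it forces one edge into the rest and its
  neighbours become seeds.  Otherwise a lobe hangs off a seed \<open>a\<close> by at least two edges; leaving one of
  these edges in the tree, the others provide seeds inside the lobe, which is treated like a closed ear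
  at \<open>a\<close> before the rest.
\<close>

theorem forcing_tree_exists:
  assumes "seeded C A r"
  shows "\<exists>T. forcing_tree C r T \<and>
    (\<forall>(N :: 'b::ab_group_add set) x. int_subspace N \<longrightarrow> propagates N x \<longrightarrow> forced C A r T N x)"
  using assms
proof (induction "card C" arbitrary: C A r rule: less_induct)
  case less
  note S = less.prems
  have fin: "finite C" "r \<in> C" "A \<subseteq> C" "A \<noteq> {}" using S unfolding seeded_def by auto
  show ?case
  proof (cases "card C = 1")
    case True
    then have C: "C = {r}" "A = {r}" using fin by (auto simp: card_1_singleton_iff)
    have "forced C A r {} N x" for N :: "'b set" and x unfolding forced_def using C by auto
    moreover have "forcing_tree C r {}" unfolding forcing_tree_def using C by auto
    ultimately show ?thesis by blast
  next
    case nontrivial: False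
    show ?thesis
    proof (cases "\<exists>a\<in>A. a \<noteq> r \<and> linked C r a")
      case True
      then obtain a where a: "a \<in> A" "a \<noteq> r" and conn: "linked C r a" by blast
      have aC: "a \<in> C" using a fin by auto
      obtain b where b: "b \<in> C" "(a, b) \<in> E" "b \<noteq> a"
        using seeded_cross[OF S, of "{a}"] a aC by blast
      let ?A = "A - {a} \<union> (E `` {a} \<inter> (C - {a}))"
      have "card (C - {a}) < card C" using aC fin by (meson card_Diff1_less)
      from less.hyps[OF this seeded_remove_seed[OF S a conn b]] obtain T where
        T: "forcing_tree (C - {a}) r T" "\<And>N (x :: 'a set \<Rightarrow> 'b). int_subspace N \<Longrightarrow> propagates N x \<Longrightarrow> forced (C - {a}) ?A r T N x"
        by blast
      have TU: "\<Union>T \<subseteq> C - {a}" using T(1) unfolding forcing_tree_def by auto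
      have "forced C A r (insert {a, b} T) N x" if "int_subspace N" "propagates N x" for N and x :: "'a set \<Rightarrow> 'b"
        by (rule forced_remove_seed[OF that T(2)[OF that] TU a aC b])
      moreover have "forcing_tree C r (insert {a, b} T)" unfolding forcing_tree_def
      proof (intro conjI ballI)
        show "insert {a, b} T \<subseteq> {{u, v} | u v. u \<in> C \<and> v \<in> C \<and> (u, v) \<in> E}"
          using T(1) aC b unfolding forcing_tree_def by blast
        have "{a, b} \<notin> T" using TU by auto
        then show "card (insert {a, b} T) + 1 = card C"
          using T(1) forcing_tree_finite[OF T(1)] fin(1) card_Suc_Diff1[OF fin(1) aC] unfolding forcing_tree_def
          by simp
        fix u assume "u \<in> C"
        have *: "(w, r) \<in> {(v, w). {v, w} \<in> insert {a, b} T}\<^sup>*" if "w \<in> C - {a}" for w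
          using T(1) that forcing_tree_mono[of w r T "insert {a, b} T"] unfolding forcing_tree_def by auto
        show "(u, r) \<in> {(v, w). {v, w} \<in> insert {a, b} T}\<^sup>*"
        proof (cases "u = a")
          case True
          then have "(u, b) \<in> {(v, w). {v, w} \<in> insert {a, b} T}" by auto
          then show ?thesis using *[of b] b by (meson Diff_iff converse_rtrancl_into_rtrancl singletonD)
        qed (use * \<open>u \<in> C\<close> in auto)
      qed
      ultimately show ?thesis by blast
    next
      case False
      then have "\<And>a. a \<in> A \<Longrightarrow> a \<noteq> r \<Longrightarrow> \<not> linked C r a" by blast
      from minimal_lobe[OF S nontrivial this] obtain a D where a: "a \<in> A" and L: "lobe C r a D" and DA: "D \<inter> A = {}"
        and min: "\<forall>X. lobe C r a X \<longrightarrow> card D \<le> card X"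
        by blast
      obtain b where b: "b \<in> D" "(a, b) \<in> E" and SD: "seeded D (E `` {a} \<inter> D - {b}) b"
        using seeded_lobe[OF S a L DA min] by blast
      note SC = seeded_remove_lobe[OF S a L DA]
      have Dsub: "a \<notin> D" "r \<notin> D" "D \<subseteq> C" "D \<noteq> {}" "D \<subseteq> C - {a, r}" using L unfolding lobe_def by auto
      have finD: "finite D" using Dsub fin finite_subset by blast
      have "D \<subset> C" using Dsub fin by auto
      then have lt: "card D < card C" "card (C - D) < card C" 
        using fin finD Dsub by (auto intro!: psubset_card_mono)
      obtain TD where
        TD: "forcing_tree D b TD" "\<And>N (x :: 'a set \<Rightarrow> 'b). int_subspace N \<Longrightarrow> propagates N x \<Longrightarrow> forced D (E `` {a} \<inter> D - {b}) b TD N x"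
        using less.hyps[OF lt(1) SD] by blast
      obtain TC where
        TC: "forcing_tree (C - D) r TC" "\<And>N (x :: 'a set \<Rightarrow> 'b). int_subspace N \<Longrightarrow> propagates N x \<Longrightarrow> forced (C - D) A r TC N x"
        using less.hyps[OF lt(2) SC] by blast
      \<comment> \<open>The edge \<open>{a, b}\<close> joins the tree of the lobe, rooted at
        \<open>b\<close>, to the tree of the rest.\<close>
      let ?T = "insert {a, b} (TD \<union> TC)"
      have U: "\<Union>TD \<subseteq> D" "\<Union>TC \<subseteq> C - D" using TD(1) TC(1) unfolding forcing_tree_def by auto
      have ne: "{} \<notin> TD" using TD(1) unfolding forcing_tree_def by auto
      have aC: "a \<in> C - D" "A \<subseteq> C - D" using a fin Dsub DA by auto
      have Dout: "v \<in> D \<or> v = a" if "(u, v) \<in> E" "u \<in> D" "v \<in> C" for u v using L that unfolding lobe_def by blast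
      have "forced C A r ?T N x" if "int_subspace N" "propagates N x" for N and x :: "'a set \<Rightarrow> 'b"
        by (rule forced_glue[OF that TD(2)[OF that] TC(2)[OF that] U Dsub(5) Dout a aC(2) b])
      moreover have "forcing_tree C r ?T" unfolding forcing_tree_def
      proof (intro conjI ballI)
        show "?T \<subseteq> {{u, v} | u v. u \<in> C \<and> v \<in> C \<and> (u, v) \<in> E}"
          using TD(1) TC(1) aC b Dsub(3) unfolding forcing_tree_def by blast
        have "{a, b} \<notin> TD \<union> TC" using U aC b by auto
        moreover have "TD \<inter> TC = {}"
        proof (rule ccontr)
          assume "TD \<inter> TC \<noteq> {}"
          then obtain e where "e \<in> TD" "e \<in> TC" by blast
          moreover from this ne obtain w where "w \<in> e" by (metis ex_in_conv)
          ultimately show False using U by blast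
        qed
        moreover have "card D + card (C - D) = card C" using finD fin(1) Dsub(3)
          by (metis card_Diff_subset card_mono le_add_diff_inverse)
        ultimately show "card ?T + 1 = card C"
          using TD(1) TC(1) forcing_tree_finite[OF TD(1)] forcing_tree_finite[OF TC(1)] fin finD 
          unfolding forcing_tree_def by (simp add: card_Un_disjoint)
        let ?R = "{(v, w). {v, w} \<in> ?T}"
        have C: "(w, r) \<in> ?R\<^sup>*" if "w \<in> C - D" for w
          using TC(1) that forcing_tree_mono[of w r TC ?T] unfolding forcing_tree_def by auto
        have D: "(w, b) \<in> ?R\<^sup>*" if "w \<in> D" for w
          using TD(1) that forcing_tree_mono[of w b TD ?T] unfolding forcing_tree_def by auto
        have ba: "(b, a) \<in> ?R" by (auto simp: insert_commute)
        fix u assume "u \<in> C"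
        show "(u, r) \<in> ?R\<^sup>*"
        proof (cases "u \<in> D")
          case True
          then show ?thesis using D[OF True] ba C[OF aC(1)] by (meson rtrancl.rtrancl_into_rtrancl rtrancl_trans)
        qed (use C \<open>u \<in> C\<close> in auto)
      qed
      ultimately show ?thesis by blast
    qed
  qed
qed

text \<open>Connectedness without reference to the root: the set tested is \<open>W\<close> or its
  complement, whichever misses \<open>r\<close>. It serves to prove that the line graph is
  connected.\<close>

lemma seeded_closed:
  assumes S: "seeded C A r" and W: "W \<subseteq> C" "W \<noteq> {}" "\<And>u v. u \<in> W \<Longrightarrow> v \<in> C \<Longrightarrow> (u, v) \<in> E \<Longrightarrow> v \<in> W"
  shows "W = C"
proof (rule ccontr)
  assume ne: "W \<noteq> C"
  show False
  proof (cases "r \<in> W")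
    case True
    then have "C - W \<subseteq> C - {r}" "C - W \<noteq> {}" using W ne by auto
    from seeded_cross[OF S this] show False using W sym_E by blast
  next
    case False
    then have "W \<subseteq> C - {r}" using W by auto
    from seeded_cross[OF S this W(2)] show False using W by blast
  qed
qed

text \<open>
  If every edge were in the tree, the constant labelling \<open>1\<close>, taken modulo the degree of \<open>r\<close>, would have
  to vanish.  It satisfies the propagation rule vacuously.
\<close>

lemma forced_imp_chord:
  assumes S: "seeded C {r} r" and "card C \<noteq> 1" and EC: "E \<subseteq> C \<times> C"
    and T: "\<And>(N :: ('k \<Rightarrow>\<^sub>0 int) set) x. int_subspace N \<Longrightarrow> propagates N x \<Longrightarrow> forced C {r} r T N x"
  shows "\<exists>u\<in>C. \<exists>v\<in>C. (u, v) \<in> E \<and> {u, v} \<notin> T"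
proof (rule ccontr)
  assume all: "\<not> ?thesis"
  have C: "finite C" "r \<in> C" using S unfolding seeded_def by auto
  let ?X = "C - {r}"
  have ne: "?X \<noteq> {}"
  proof
    assume "?X = {}"
    then have "C = {r}" using C by auto
    then show False using \<open>card C \<noteq> 1\<close> by simp
  qed
  \<comment> \<open>Both edges leaving \<open>C - {r}\<close> end at \<open>r\<close>. Hence
    \<open>r\<close> has degree at least 2, and 1 does not vanish modulo the degree.\<close>
  obtain u v where ur: "(u, r) \<in> E" "(v, r) \<in> E" "u \<noteq> v" "u \<in> C"
    using seeded_cross2[OF S subset_refl ne] by blast
  have "{u, v} \<subseteq> E `` {r}" "card {u, v} = 2" using ur sym_E by auto
  then have "2 \<le> card (E `` {r})" using card_mono[OF finite_nbrs] by metis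
  define k :: 'k where "k = undefined"
  define d where "d = int (card (E `` {r}))"
  \<comment> \<open>Vanishing modulo \<open>d\<close>, read off at the arbitrary index
    \<open>k\<close>; here \<open>frag_of k\<close> plays the part of 1.\<close>
  define N where "N = {c :: 'k \<Rightarrow>\<^sub>0 int. d dvd Poly_Mapping.lookup c k}"
  have d: "d \<ge> 2" using \<open>2 \<le> card (E `` {r})\<close> unfolding d_def by simp
  then have nd: "frag_of k \<notin> N" unfolding N_def by auto
  have "int_subspace N" unfolding int_subspace_def N_def by (auto simp: lookup_minus)
  moreover have "propagates N (\<lambda>_. frag_of k)" unfolding propagates_def using nd by blast
  ultimately have "forced C {r} r T N (\<lambda>_. frag_of k)" by (rule T)
  moreover have "star_sum (\<lambda>_. frag_of k) a \<in> N" if "a \<in> {r}" for a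
    using that
    unfolding star_sum_def N_def d_def by (simp add: lookup_sum)
  ultimately have "frag_of k \<in> N"
    using forcedD(1)[of C "{r}" r T N "\<lambda>_. frag_of k" u r] ur(1,4) C(2) all EC by blast
  then show False using nd by blast
qed

end

section \<open>Chords and independent cycles\<close>

text \<open>Deleting the only edge that leaves a set would separate its two ends, so that edge would
  be a cut-edge.\<close>

lemma seeded_two_edge_connected:
  assumes "pair_graph G" "two_edge_connected G" "r \<in> pverts G"
  shows "finite_sym_rel (parcs G)" "finite_sym_rel.seeded (parcs G) (pverts G) {r} r"
proof -
  interpret G: pair_graph G by fact
  show rel: "finite_sym_rel (parcs G)"
    using G.pair_finite_arcs G.arcs_symmetric by unfold_locales auto
  then interpret R: finite_sym_rel "parcs G" .
  have conn: "u \<rightarrow>\<^sup>*\<^bsub>with_proj G\<^esub> v" if "u \<in> pverts G" "v \<in> pverts G" for u v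
    using assms(2) that G.reachable_mk_symmetric_eq[OF G.sym_arcs]
    unfolding two_edge_connected_def connected_def strongly_connected_def by auto
  have stay: "v \<in> X" if "u \<rightarrow>\<^sup>*\<^bsub>with_proj H\<^esub> v" "u \<in> X" "\<And>p q. (p, q) \<in> parcs H \<Longrightarrow> p \<in> X \<Longrightarrow> q \<in> X"
    for H :: "'a pair_pre_digraph" and u v X
    using that(1) unfolding reachable_def
    by (induction rule: rtrancl_on_induct) (use that in auto)
  \<comment> \<open>With at most one component in \<open>G\<close>, two distinct components after a
    deletion suffice for a cut-edge.\<close>
  have one_comp: "num_components G \<le> 1"
  proof -
    have "S = pverts G" if S: "S \<in> pre_digraph.sccs_verts (with_proj G)" for S
    proof -
      have "S \<subseteq> pverts G" using G.sccs_verts_subsets[OF S] by simp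
      moreover obtain u where "u \<in> S" using S unfolding pre_digraph.sccs_verts_def by blast
      ultimately show ?thesis using S conn unfolding pre_digraph.sccs_verts_def by blast
    qed
    then have "pre_digraph.sccs_verts (with_proj G) \<subseteq> {pverts G}" by auto
    then show ?thesis unfolding num_components_def using card_mono[of "{pverts G}"] by fastforce
  qed
  show "R.seeded (pverts G) {r} r"
  proof (rule R.seededI)
    fix X assume X: "X \<subseteq> pverts G - {r}" "X \<noteq> {}"
    obtain u where u: "u \<in> X" using X by blast
    show ex: "\<exists>u v. (u, v) \<in> parcs G \<and> u \<in> X \<and> v \<in> pverts G \<and> v \<notin> X"
    proof (rule ccontr)
      assume n: "\<not> ?thesis"
      have "u \<rightarrow>\<^sup>*\<^bsub>with_proj G\<^esub> r" using conn u X assms(3) by blast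
      then have "r \<in> X" by (rule stay) (use n u G.in_arcsD2 in blast)+
      then show False using X by blast
    qed
    show "\<exists>u v u' v'. (u, v) \<in> parcs G \<and> u \<in> X \<and> v \<in> pverts G \<and> v \<notin> X \<and>
      (u', v') \<in> parcs G \<and> u' \<in> X \<and> v' \<in> pverts G \<and> v' \<notin> X \<and> (u, v) \<noteq> (u', v')"
    proof (rule ccontr)
      assume n: "\<not> ?thesis"
      obtain p q where pq: "(p, q) \<in> parcs G" "p \<in> X" "q \<in> pverts G" "q \<notin> X" using ex by blast
      have un: "p' = p \<and> q' = q" if "(p', q') \<in> parcs G" "p' \<in> X" "q' \<notin> X" for p' q'
        using n pq that G.in_arcsD2 by blast
      let ?H = "del_edge G p q"
      interpret H: pair_fin_digraph ?H
        using G.pair_finite_arcs G.pair_finite_verts G.in_arcsD1 G.in_arcsD2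
        by unfold_locales (auto simp: del_edge_def)
      have pv: "p \<in> pverts ?H" "q \<in> pverts ?H" using pq X by (auto simp: del_edge_def)
      have "\<not> p \<rightarrow>\<^sup>*\<^bsub>with_proj ?H\<^esub> q"
      proof
        assume "p \<rightarrow>\<^sup>*\<^bsub>with_proj ?H\<^esub> q"
        then have "q \<in> X" by (rule stay) (use un pq(2) in \<open>auto simp: del_edge_def\<close>)
        then show False using pq by blast
      qed
      then have "H.scc_of p \<noteq> H.scc_of q" using H.in_scc_of_self[of q] pv unfolding H.scc_of_def by auto
      moreover have "H.scc_of p \<in> H.sccs_verts" "H.scc_of q \<in> H.sccs_verts"
        using H.scc_of_in_sccs_verts pv by auto
      ultimately have "card {H.scc_of p, H.scc_of q} = 2" "{H.scc_of p, H.scc_of q} \<subseteq> H.sccs_verts"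
        by simp_all
      moreover from this(2) have "card {H.scc_of p, H.scc_of q} \<le> card H.sccs_verts"
        using H.finite_sccs_verts by (intro card_mono)
      ultimately have "num_components G < num_components ?H" using one_comp unfolding num_components_def by auto
      then have "cut_edge G p q" using pq unfolding cut_edge_def by auto
      then show False using assms(2) unfolding two_edge_connected_def by blast
    qed
  qed (use assms G.pair_finite_verts in auto)
qed

section \<open>Boundaries of chains\<close>

lemma boundary_frag_of: "boundary (frag_of (u, v)) = frag_of v - frag_of u"
  unfolding boundary_def by simp

lemma boundary_diff: "boundary (x - y) = boundary x - boundary y"
  unfolding boundary_def by (rule frag_extend_diff)

lemma boundary_add: "boundary (x + y) = boundary x + boundary y"
  unfolding boundary_def by (rule frag_extend_add)

lemma boundary_zero: "boundary 0 = 0"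
  unfolding boundary_def by simp

lemma boundary_sum: "finite I \<Longrightarrow> boundary (sum g I) = (\<Sum>i\<in>I. boundary (g i))"
  unfolding boundary_def by (simp add: frag_extend_sum comp_def)

text \<open>An arc walked forwards is added and one walked backwards is subtracted, so that the
  boundaries telescope.\<close>

lemma chain_of_path:
  assumes "(u, w) \<in> {(v, w). (v, w) \<in> P \<or> (w, v) \<in> P}\<^sup>*"
  shows "\<exists>t. Poly_Mapping.keys t \<subseteq> P \<and> boundary t = frag_of w - frag_of u"
  using assms
proof (induction rule: rtrancl_induct)
  case base
  show ?case by (rule exI[of _ 0]) (simp add: boundary_zero)
next
  case (step v w)
  then obtain t where t: "Poly_Mapping.keys t \<subseteq> P" "boundary t = frag_of v - frag_of u" by blast
  consider "(v, w) \<in> P" | "(w, v) \<in> P" using step by blast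
  then show ?case
  proof cases
    case 1
    have "Poly_Mapping.keys (t + frag_of (v, w)) \<subseteq> P" using t 1 keys_add[of t "frag_of (v, w)"] by auto
    then show ?thesis using t by (intro exI[of _ "t + frag_of (v, w)"]) (simp add: boundary_add boundary_frag_of)
  next
    case 2
    have "Poly_Mapping.keys (t - frag_of (w, v)) \<subseteq> P" using t 2 keys_diff[of t "frag_of (w, v)"] by auto
    then show ?thesis using t by (intro exI[of _ "t - frag_of (w, v)"]) (simp add: boundary_diff boundary_frag_of)
  qed
qed

section \<open>Linear independence over the integers\<close>

lemma module_frag_cmul: "module frag_cmul"
  by unfold_locales (simp_all add: frag_cmul_distrib frag_cmul_distrib2)

text \<open>Gaussian elimination without fractions: a vector with a nonzero entry at
  \<open>b\<close> clears this coordinate from the others, at the cost of one vector and one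
  coordinate.\<close>

lemma integer_relation_exists:
  fixes v :: "'i \<Rightarrow> 'k \<Rightarrow>\<^sub>0 int"
  assumes "finite B" "finite I" "card B < card I" "\<And>i. i \<in> I \<Longrightarrow> Poly_Mapping.keys (v i) \<subseteq> B"
  shows "\<exists>c. (\<exists>i\<in>I. c i \<noteq> 0) \<and> (\<Sum>i\<in>I. frag_cmul (c i) (v i)) = 0"
  using assms
proof (induction B arbitrary: I v rule: finite_induct)
  case empty
  then obtain i where "i \<in> I" by fastforce
  moreover have "v i = 0" if "i \<in> I" for i using empty.prems(3)[OF that] by simp
  ultimately show ?case by (intro exI[of _ "\<lambda>_. 1"]) auto
next
  case (insert b B)
  show ?case
  proof (cases "\<forall>i\<in>I. Poly_Mapping.lookup (v i) b = 0")
    case True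
    then have "Poly_Mapping.keys (v i) \<subseteq> B" if "i \<in> I" for i
      using insert.prems(3)[OF that] that by (auto simp: in_keys_iff subset_iff)
    then show ?thesis using insert.IH[of I v] insert.prems insert.hyps by simp
  next
    case False
    then obtain j where j: "j \<in> I" "Poly_Mapping.lookup (v j) b \<noteq> 0" by blast
    \<comment> \<open>Cross-multiplication with the pivot \<open>v j\<close> cancels the coordinate
      \<open>b\<close> without division.\<close>
    define w where "w = (\<lambda>i. frag_cmul (Poly_Mapping.lookup (v j) b) (v i) - frag_cmul (Poly_Mapping.lookup (v i) b) (v j))"
    have "Poly_Mapping.keys (w i) \<subseteq> B" if "i \<in> I - {j}" for i
    proof
      fix k assume k: "k \<in> Poly_Mapping.keys (w i)"
      have "k \<noteq> b" using k unfolding w_def by (auto simp: in_keys_iff lookup_minus)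
      moreover have "k \<in> Poly_Mapping.keys (v i) \<or> k \<in> Poly_Mapping.keys (v j)"
        using k unfolding w_def by (auto simp: in_keys_iff lookup_minus)
      ultimately show "k \<in> B" using insert.prems(3)[of i] insert.prems(3)[of j] that j by blast
    qed
    moreover have "card B < card (I - {j})" using insert.prems insert.hyps j by simp
    ultimately obtain c where c: "\<exists>i\<in>I - {j}. c i \<noteq> 0" "(\<Sum>i\<in>I - {j}. frag_cmul (c i) (w i)) = 0"
      using insert.IH[of "I - {j}" w] insert.prems by auto
    \<comment> \<open>Expanding each \<open>w i\<close> in the relation gives these coefficients.
      Those of the other vectors are merely scaled by the nonzero pivot entry, so the relation stays
      nontrivial.\<close>
    define c' where "c' = (\<lambda>i. if i = j then - (\<Sum>i\<in>I - {j}. c i * Poly_Mapping.lookup (v i) b) else c i * Poly_Mapping.lookup (v j) b)"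
    have "(\<Sum>i\<in>I. frag_cmul (c' i) (v i)) = frag_cmul (c' j) (v j) + (\<Sum>i\<in>I - {j}. frag_cmul (c' i) (v i))"
      using insert.prems j by (simp add: sum.remove)
    also have "(\<Sum>i\<in>I - {j}. frag_cmul (c' i) (v i)) = (\<Sum>i\<in>I - {j}. frag_cmul (c i) (w i) + frag_cmul (c i * Poly_Mapping.lookup (v i) b) (v j))"
      by (rule sum.cong) (auto simp: c'_def w_def intro!: poly_mapping_eqI simp: lookup_add lookup_minus algebra_simps)
    also have "\<dots> = (\<Sum>i\<in>I - {j}. frag_cmul (c i * Poly_Mapping.lookup (v i) b) (v j))"
      using c(2) by (simp add: sum.distrib)
    also have "\<dots> = frag_cmul (\<Sum>i\<in>I - {j}. c i * Poly_Mapping.lookup (v i) b) (v j)"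
      by (intro poly_mapping_eqI) (simp add: lookup_sum sum_distrib_right)
    also have "frag_cmul (c' j) (v j) + \<dots> = 0"
      by (intro poly_mapping_eqI) (simp add: c'_def lookup_add)
    finally have "(\<Sum>i\<in>I. frag_cmul (c' i) (v i)) = 0" .
    moreover have "\<exists>i\<in>I. c' i \<noteq> 0" using c(1) j unfolding c'_def by auto
    ultimately show ?thesis by blast
  qed
qed

lemma card_independent_le:
  assumes "finite B" "finite S" "\<And>s. s \<in> S \<Longrightarrow> Poly_Mapping.keys s \<subseteq> B"
    and "\<not> module.dependent frag_cmul S"
  shows "card S \<le> card B"
proof (rule ccontr)
  assume "\<not> ?thesis"
  then obtain c where "\<exists>s\<in>S. c s \<noteq> 0" "(\<Sum>s\<in>S. frag_cmul (c s) s) = 0"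
    using integer_relation_exists[of B S "\<lambda>s. s"] assms by auto
  then show False using assms(2,4) module.dependent_finite[OF module_frag_cmul assms(2)] by blast
qed

text \<open>\<open>Max\<close> is informative only over a finite set; the number of arcs bounds the
  size of every independent family.\<close>

lemma num_independent_cycles_ge:
  assumes "finite (parcs D)" "S \<subseteq> cycle_lattice D" "finite S" "\<not> module.dependent frag_cmul S"
  shows "card S \<le> \<beta> D"
proof -
  let ?M = "{card S | S. S \<subseteq> cycle_lattice D \<and> finite S \<and> \<not> module.dependent frag_cmul S}"
  have "?M \<subseteq> {..card (parcs D)}"
  proof
    fix n assume "n \<in> ?M"
    then obtain S where S: "S \<subseteq> cycle_lattice D" "finite S" "\<not> module.dependent frag_cmul S" "n = card S"
      by blast
    have "Poly_Mapping.keys s \<subseteq> parcs D" if "s \<in> S" for s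
      using S(1) that unfolding cycle_lattice_def kernel_def edge_group_def by auto
    then show "n \<in> {..card (parcs D)}" using card_independent_le[OF assms(1) S(2) _ S(3)] S(4) by simp
  qed
  then have "finite ?M" using finite_subset by blast
  then show ?thesis unfolding num_independent_cycles_def using assms by (intro Max_ge) auto
qed

lemma mem_cycle_lattice_iff:
  "h \<in> cycle_lattice D \<longleftrightarrow> Poly_Mapping.keys h \<subseteq> parcs D \<and> boundary h = 0"
  unfolding cycle_lattice_def kernel_def edge_group_def vertex_group_def by auto

text \<open>Each chord is closed up by tree arcs to its fundamental cycle. This cycle contains no
  other chord, so the fundamental cycles are independent.\<close>

lemma card_chords_le_num_independent_cycles:
  assumes G: "finite_sym_rel (parcs G)" and D: "orientation G D" and "parcs G \<subseteq> pverts G \<times> pverts G"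
    and T: "finite_sym_rel.forcing_tree (parcs G) (pverts G) r T"
  shows "card (edges G - T) \<le> \<beta> D"
proof -
  interpret R: finite_sym_rel "parcs G" by fact
  have finE: "finite (edges G)" unfolding edges_def using R.finite_E by auto
  have DG: "parcs D \<subseteq> parcs G" using D unfolding orientation_def by auto
  have finD: "finite (parcs D)" using finite_subset[OF DG R.finite_E] .
  let ?P = "{(u, v) \<in> parcs D. {u, v} \<in> T}"
  have tree: "T \<subseteq> {{u, v} | u v. u \<in> pverts G \<and> v \<in> pverts G \<and> (u, v) \<in> parcs G}"
    "\<And>u. u \<in> pverts G \<Longrightarrow> (u, r) \<in> {(v, w). {v, w} \<in> T}\<^sup>*"
    using T unfolding R.forcing_tree_def by auto
  have "(v, w) \<in> ?P \<or> (w, v) \<in> ?P" if vw: "{v, w} \<in> T" for v w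
  proof -
    obtain v' w' where "{v, w} = {v', w'}" "(v', w') \<in> parcs G" using tree(1) vw by blast
    then have "(v, w) \<in> parcs G" using R.sym_E by (auto simp: doubleton_eq_iff)
    then have "(v, w) \<in> parcs D \<or> (w, v) \<in> parcs D" using D unfolding orientation_def by blast
    then show ?thesis using vw by (auto simp: insert_commute)
  qed
  then have "{(v, w). {v, w} \<in> T} \<subseteq> {(v, w). (v, w) \<in> ?P \<or> (w, v) \<in> ?P}" by blast
  then have path: "(u, r) \<in> {(v, w). (v, w) \<in> ?P \<or> (w, v) \<in> ?P}\<^sup>*" if "u \<in> pverts G" for u
    using tree(2)[OF that] rtrancl_mono by blast
  \<comment> \<open>The pair \<open>p\<close> holds the arc of \<open>D\<close> that represents the
    chord and a chain of tree arcs with the same boundary.\<close>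
  have "\<forall>f\<in>edges G - T. \<exists>p. fst p \<in> parcs D \<and> {fst (fst p), snd (fst p)} = f \<and>
    Poly_Mapping.keys (snd p) \<subseteq> ?P \<and> boundary (snd p) = boundary (frag_of (fst p))"
  proof
    fix f assume "f \<in> edges G - T"
    then obtain u v where uv: "f = {u, v}" "(u, v) \<in> parcs G" unfolding edges_def by auto
    then have "\<exists>a b. (a, b) \<in> parcs D \<and> f = {a, b}"
      using D R.sym_E unfolding orientation_def by (metis insert_commute)
    then obtain a b where ab: "(a, b) \<in> parcs D" "f = {a, b}" by blast
    then have "a \<in> pverts G" "b \<in> pverts G" using DG assms(3) by auto
    then obtain s t where "Poly_Mapping.keys s \<subseteq> ?P" "boundary s = frag_of r - frag_of a"
       "Poly_Mapping.keys t \<subseteq> ?P" "boundary t = frag_of r - frag_of b"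
      using chain_of_path[OF path] by meson
    moreover from this have "Poly_Mapping.keys (s - t) \<subseteq> ?P" using keys_diff[of s t] by blast
    \<comment> \<open>The chain \<open>s\<close> leads from \<open>a\<close> to the root and
      \<open>t\<close> from \<open>b\<close> to the root, so \<open>s - t\<close> leads from
      \<open>a\<close> to \<open>b\<close>.\<close>
    ultimately show "\<exists>p. fst p \<in> parcs D \<and> {fst (fst p), snd (fst p)} = f \<and>
      Poly_Mapping.keys (snd p) \<subseteq> ?P \<and> boundary (snd p) = boundary (frag_of (fst p))"
      using ab by (intro exI[of _ "((a, b), s - t)"]) (simp add: boundary_diff boundary_frag_of)
  qed
  from bchoice[OF this] obtain h where h: "\<forall>f\<in>edges G - T. fst (h f) \<in> parcs D \<and>
    {fst (fst (h f)), snd (fst (h f))} = f \<and> Poly_Mapping.keys (snd (h f)) \<subseteq> ?P \<and>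
    boundary (snd (h f)) = boundary (frag_of (fst (h f)))" ..
  define arc tp where "arc = (\<lambda>f. fst (h f))" and "tp = (\<lambda>f. snd (h f))"
  have at: "\<And>f. f \<in> edges G - T \<Longrightarrow> arc f \<in> parcs D"
    "\<And>f. f \<in> edges G - T \<Longrightarrow> {fst (arc f), snd (arc f)} = f"
    "\<And>f. f \<in> edges G - T \<Longrightarrow> Poly_Mapping.keys (tp f) \<subseteq> ?P"
    "\<And>f. f \<in> edges G - T \<Longrightarrow> boundary (tp f) = boundary (frag_of (arc f))"
    using h unfolding arc_def tp_def by simp_all
  define z where "z = (\<lambda>f. frag_of (arc f) - tp f)"
  \<comment> \<open>The cycle of \<open>f\<close> has coefficient 1 at its own chord and 0 at all
    others, which yields both injectivity and independence.\<close>
  have lk: "Poly_Mapping.lookup (z f) (arc g) = (if f = g then 1 else 0)" if "f \<in> edges G - T" "g \<in> edges G - T" for f g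
  proof -
    have "arc g \<notin> ?P" using at(2)[OF that(2)] that by (auto simp: split_beta)
    then have "Poly_Mapping.lookup (tp f) (arc g) = 0" using at(3)[OF that(1)] by (meson in_keys_iff subsetD)
    moreover have "arc f = arc g \<longleftrightarrow> f = g" using at(2) that by metis
    ultimately show ?thesis unfolding z_def by (auto simp: lookup_minus)
  qed
  let ?S = "z ` (edges G - T)"
  have inj: "inj_on z (edges G - T)"
    using lk by (metis (no_types, lifting) inj_onI zero_neq_one)
  have "z f \<in> cycle_lattice D" if "f \<in> edges G - T" for f
    using at[OF that] keys_diff[of "frag_of (arc f)" "tp f"] unfolding z_def mem_cycle_lattice_iff
    by (auto simp: boundary_diff keys_frag_of)
  moreover have "\<not> module.dependent frag_cmul ?S"
  proof
    assume "module.dependent frag_cmul ?S"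
    then obtain u where u: "\<exists>s\<in>?S. u s \<noteq> 0" "(\<Sum>s\<in>?S. frag_cmul (u s) s) = 0"
      using module.dependent_finite[OF module_frag_cmul, of ?S] finE by auto
    then obtain g where g: "g \<in> edges G - T" "u (z g) \<noteq> 0" by blast
    have "0 = Poly_Mapping.lookup (\<Sum>f\<in>edges G - T. frag_cmul (u (z f)) (z f)) (arc g)"
      using u(2) by (simp add: sum.reindex[OF inj])
    also have "\<dots> = (\<Sum>f\<in>edges G - T. if f = g then u (z f) else 0)"
      unfolding lookup_sum by (rule sum.cong) (use lk g in auto)
    also have "\<dots> = u (z g)" using g finE by (simp add: sum.delta')
    finally show False using g by simp
  qed
  ultimately have "card ?S \<le> \<beta> D" using finE by (intro num_independent_cycles_ge[OF finD]) auto
  then show ?thesis using card_image[OF inj] by simp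
qed

section \<open>The critical group of the line graph\<close>

lemma coboundary_frag_of:
  "coboundary D (frag_of w) =
    (\<Sum>a\<in>in_arcs (with_proj D) w. frag_of a) - (\<Sum>a\<in>out_arcs (with_proj D) w. frag_of a)"
  unfolding coboundary_def by simp

lemma mult_edge_group [simp]: "x \<otimes>\<^bsub>edge_group D\<^esub> y = x + y"
  unfolding edge_group_def by simp

lemma one_edge_group [simp]: "\<one>\<^bsub>edge_group D\<^esub> = 0"
  unfolding edge_group_def by simp

lemma mem_critical_relations_iff:
  "h \<in> bond_lattice D <#>\<^bsub>edge_group D\<^esub> cycle_lattice D \<longleftrightarrow>
    (\<exists>x c. Poly_Mapping.keys x \<subseteq> pverts D \<and> c \<in> cycle_lattice D \<and> h = coboundary D x + c)"
  unfolding set_mult_def bond_lattice_def vertex_group_def mult_edge_group by auto blast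

lemma keys_coboundary:
  "Poly_Mapping.keys (coboundary D x) \<subseteq> parcs D"
proof -
  have "Poly_Mapping.keys ((\<Sum>a\<in>in_arcs (with_proj D) w. frag_of a) -
    (\<Sum>a\<in>out_arcs (with_proj D) w. frag_of a)) \<subseteq> parcs D" for w
    using keys_diff keys_sum[of frag_of "in_arcs (with_proj D) w"] keys_sum[of frag_of "out_arcs (with_proj D) w"]
    by (fastforce simp: keys_frag_of)
  then show ?thesis unfolding coboundary_def by (intro order_trans[OF keys_frag_extend]) auto
qed

lemma normal_critical_relations:
  "(bond_lattice D <#>\<^bsub>edge_group D\<^esub> cycle_lattice D) \<lhd> edge_group D" (is "?J \<lhd> _")
proof -
  interpret H: comm_group "edge_group D"
    unfolding edge_group_def by (rule abelian_free_Abelian_group)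
  have "subgroup ?J (edge_group D)"
  proof (rule H.subgroupI)
    show "?J \<subseteq> carrier (edge_group D)"
    proof
      fix h assume "h \<in> ?J"
      then obtain x c where "c \<in> cycle_lattice D" "h = coboundary D x + c"
        unfolding mem_critical_relations_iff by blast
      then show "h \<in> carrier (edge_group D)"
        using keys_add[of "coboundary D x" c] keys_coboundary[of D x]
        unfolding mem_cycle_lattice_iff edge_group_def by auto
    qed
    then have inv: "inv\<^bsub>edge_group D\<^esub> h = - h" if "h \<in> ?J" for h
      using that unfolding edge_group_def by auto
    have "0 \<in> ?J" unfolding mem_critical_relations_iff
      by (intro exI[of _ 0]) (simp add: coboundary_def mem_cycle_lattice_iff boundary_zero)
    then show "?J \<noteq> {}" by blast
    fix g assume g: "g \<in> ?J"
    then obtain x c where x: "Poly_Mapping.keys x \<subseteq> pverts D" "c \<in> cycle_lattice D" "g = coboundary D x + c"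
      unfolding mem_critical_relations_iff by blast
    have "boundary (- c) = - boundary c" using boundary_diff[of 0 c] by (simp add: boundary_zero)
    then have "- c \<in> cycle_lattice D" "Poly_Mapping.keys (- x) \<subseteq> pverts D"
      "- g = coboundary D (- x) + - c"
      using x by (auto simp: mem_cycle_lattice_iff coboundary_def frag_extend_minus)
    then show "inv\<^bsub>edge_group D\<^esub> g \<in> ?J" unfolding inv[OF g] mem_critical_relations_iff by blast
    fix h assume "h \<in> ?J"
    then obtain y d where y: "Poly_Mapping.keys y \<subseteq> pverts D" "d \<in> cycle_lattice D" "h = coboundary D y + d"
      unfolding mem_critical_relations_iff by blast
    have "c + d \<in> cycle_lattice D" "Poly_Mapping.keys (x + y) \<subseteq> pverts D"
      "g + h = coboundary D (x + y) + (c + d)"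
      using x y keys_add[of x y] keys_add[of c d]
      by (auto simp: mem_cycle_lattice_iff coboundary_def frag_extend_add boundary_add)
    then show "g \<otimes>\<^bsub>edge_group D\<^esub> h \<in> ?J"
      unfolding mem_critical_relations_iff mult_edge_group by blast
  qed
  then show ?thesis by (simp add: H.normal_iff_subgroup)
qed

text \<open>
  The boundary map identifies the critical group with a quotient of the group of boundaries, so that
  generation can be tested after applying it.
\<close>

lemma critical_group_generated:
  assumes gens: "\<And>g. g \<in> Gs \<Longrightarrow> Poly_Mapping.keys g \<subseteq> parcs D"
    and test: "\<And>N a. int_subspace N \<Longrightarrow> (\<And>w. w \<in> pverts D \<Longrightarrow> boundary (coboundary D (frag_of w)) \<in> N) \<Longrightarrow>
      (\<And>g. g \<in> Gs \<Longrightarrow> boundary g \<in> N) \<Longrightarrow> a \<in> parcs D \<Longrightarrow> boundary (frag_of a) \<in> N"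
  defines "q \<equiv> \<lambda>h. (bond_lattice D <#>\<^bsub>edge_group D\<^esub> cycle_lattice D) #>\<^bsub>edge_group D\<^esub> h"
  shows "q ` Gs \<subseteq> carrier (critical_group D)"
    and "generate (critical_group D) (q ` Gs) = carrier (critical_group D)"
proof -
  let ?J = "bond_lattice D <#>\<^bsub>edge_group D\<^esub> cycle_lattice D"
  interpret J: normal ?J "edge_group D" by (rule normal_critical_relations)
  have K: "critical_group D = edge_group D Mod ?J" unfolding critical_group_def ..
  interpret K: group "critical_group D" unfolding K by (rule J.factorgroup_is_group)
  have hom: "q \<in> hom (edge_group D) (critical_group D)" unfolding q_def K by (rule J.r_coset_hom_Mod)
  interpret q: group_hom "edge_group D" "critical_group D" q
    using hom by unfold_locales
  have carr: "h \<in> carrier (edge_group D) \<longleftrightarrow> Poly_Mapping.keys h \<subseteq> parcs D" for h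
    unfolding edge_group_def by simp
  have surj: "carrier (critical_group D) = q ` carrier (edge_group D)"
    unfolding K q_def carrier_FactGroup ..
  show sub: "q ` Gs \<subseteq> carrier (critical_group D)" using gens carr surj by auto
  let ?W = "generate (critical_group D) (q ` Gs)"
  have W: "subgroup ?W (critical_group D)" by (rule K.generate_is_subgroup[OF sub])
  \<comment> \<open>The preimage of the generated subgroup. It contains all relations, and the test
    applied to its image under \<open>boundary\<close> shows that every arc lies in it up to a
    cycle.\<close>
  define M where "M = {h. Poly_Mapping.keys h \<subseteq> parcs D \<and> q h \<in> ?W}"
  have J_M: "h \<in> M" if "h \<in> ?J" for h
  proof -
    have "h \<in> carrier (edge_group D)" using that J.subset by blast
    moreover have "q h = \<one>\<^bsub>critical_group D\<^esub>" unfolding q_def K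
      using J.rcos_const that by (simp add: J.is_group)
    ultimately show ?thesis unfolding M_def carr using W subgroup.one_closed by fastforce
  qed
  have M0: "0 \<in> M" using J_M[OF subgroup.one_closed[OF J.subgroup_axioms]] by simp
  have M_diff: "a - b \<in> M" if "a \<in> M" "b \<in> M" for a b
  proof -
    have ab: "Poly_Mapping.keys a \<subseteq> parcs D" "Poly_Mapping.keys b \<subseteq> parcs D" "q a \<in> ?W" "q b \<in> ?W"
      using that unfolding M_def by auto
    have diff: "a - b = a \<otimes>\<^bsub>edge_group D\<^esub> inv\<^bsub>edge_group D\<^esub> b"
      using ab unfolding edge_group_def by simp
    have "q (a \<otimes>\<^bsub>edge_group D\<^esub> inv\<^bsub>edge_group D\<^esub> b) =
      q a \<otimes>\<^bsub>critical_group D\<^esub> inv\<^bsub>critical_group D\<^esub> (q b)"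
      using ab(1,2) unfolding carr[symmetric] by (simp only: q.hom_mult q.hom_inv J.inv_closed)
    moreover have "q a \<otimes>\<^bsub>critical_group D\<^esub> inv\<^bsub>critical_group D\<^esub> (q b) \<in> ?W"
      by (rule subgroup.m_closed[OF W ab(3) subgroup.m_inv_closed[OF W ab(4)]])
    ultimately have "q (a - b) \<in> ?W" unfolding diff by (simp only:)
    then show ?thesis using ab(1,2) keys_diff[of a b] unfolding M_def by blast
  qed
  have "int_subspace (boundary ` M)" unfolding int_subspace_def
  proof (intro conjI ballI)
    show "0 \<in> boundary ` M" using M0 boundary_zero by force
    fix a b assume "a \<in> boundary ` M" "b \<in> boundary ` M"
    then obtain g h where "g \<in> M" "h \<in> M" "a - b = boundary (g - h)" by (auto simp: boundary_diff)
    then show "a - b \<in> boundary ` M" using M_diff by blast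
  qed
  moreover have "boundary (coboundary D (frag_of w)) \<in> boundary ` M" if "w \<in> pverts D" for w
  proof -
    have "coboundary D (frag_of w) \<in> ?J" unfolding mem_critical_relations_iff
      using that by (intro exI[of _ "frag_of w"] exI[of _ 0]) (simp add: mem_cycle_lattice_iff boundary_zero)
    then show ?thesis using J_M by blast
  qed
  moreover have "boundary g \<in> boundary ` M" if "g \<in> Gs" for g
    using gens[OF that] that unfolding M_def by (auto intro: generate.incl)
  ultimately have bd: "boundary (frag_of a) \<in> boundary ` M" if "a \<in> parcs D" for a
    using test that by blast
  have M_add: "a + b \<in> M" if "a \<in> M" "b \<in> M" for a b
    using M_diff[OF that(1) M_diff[OF M0 that(2)]] by simp
  \<comment> \<open>The arc and \<open>h\<close> differ by a cycle, which is a relation and hence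
    lies in \<open>M\<close>.\<close>
  have arc: "frag_of a \<in> M" if a: "a \<in> parcs D" for a
  proof -
    obtain h where h: "h \<in> M" "boundary (frag_of a) = boundary h" using bd[OF a] by blast
    have "frag_of a - h \<in> cycle_lattice D"
      using h a keys_diff[of "frag_of a" h] unfolding mem_cycle_lattice_iff M_def
      by (auto simp: boundary_diff keys_frag_of)
    then have "frag_of a - h \<in> ?J" unfolding mem_critical_relations_iff
      by (intro exI[of _ 0] exI[of _ "frag_of a - h"]) (simp add: coboundary_def)
    then show ?thesis using M_add[OF J_M h(1)] by fastforce
  qed
  have "x \<in> M" if "Poly_Mapping.keys x \<subseteq> parcs D" for x
    using that by (rule free_Abelian_group_induct) (use M0 M_diff arc in auto)
  then have "q x \<in> ?W" if "x \<in> carrier (edge_group D)" for x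
    using that unfolding M_def carr by blast
  then have "carrier (critical_group D) \<subseteq> ?W" unfolding surj by blast
  then show "?W = carrier (critical_group D)"
    using subgroup.subset[OF W] by (rule subset_antisym[rotated])
qed

text \<open>The composite is the graph Laplacian. Reversing an arc changes its sign in both maps, so
  the orientation drops out.\<close>

lemma boundary_coboundary_frag_of:
  assumes fin: "finite (parcs H)" and sym: "\<And>u v. (u, v) \<in> parcs H \<Longrightarrow> (v, u) \<in> parcs H"
    and D: "orientation H D"
  shows "boundary (coboundary D (frag_of w)) = (\<Sum>u\<in>parcs H `` {w}. frag_of w - frag_of u)"
proof -
  let ?I = "{u. (u, w) \<in> parcs D}" and ?O = "{u. (w, u) \<in> parcs D}"
  have nb: "parcs H `` {w} = ?I \<union> ?O" "?I \<inter> ?O = {}"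
    using D sym unfolding orientation_def by blast+
  have "finite (parcs H `` {w})" using fin by (rule finite_Image)
  then have finIO: "finite ?I" "finite ?O" unfolding nb by auto
  have arcs: "in_arcs (with_proj D) w = (\<lambda>u. (u, w)) ` ?I" "out_arcs (with_proj D) w = (\<lambda>u. (w, u)) ` ?O"
    by (auto simp: in_arcs_def out_arcs_def)
  have "coboundary D (frag_of w) = (\<Sum>u\<in>?I. frag_of (u, w)) - (\<Sum>u\<in>?O. frag_of (w, u))"
    unfolding coboundary_frag_of arcs by (simp add: sum.reindex inj_on_def)
  then have "boundary (coboundary D (frag_of w)) = (\<Sum>u\<in>?I. frag_of w - frag_of u) + (\<Sum>u\<in>?O. frag_of w - frag_of u)"
    using finIO by (simp add: boundary_diff boundary_sum boundary_frag_of sum_subtractf)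
  then show ?thesis unfolding nb(1) using finIO nb(2) by (simp add: sum.union_disjoint)
qed

lemma doubleton_mem_edges_iff: "{u, v} \<in> edges G \<longleftrightarrow> (u, v) \<in> parcs G \<or> (v, u) \<in> parcs G"
  unfolding edges_def by (auto simp: doubleton_eq_iff)

text \<open>This is \<open>(d(u) + d(v)) e - s(u) - s(v)\<close> for \<open>e = {u, v}\<close>. The
  edge \<open>e\<close> itself contributes zero to both sums, so they can run over all
  neighbours.\<close>

lemma boundary_coboundary_line_graph:
  assumes G: "pair_graph G" and L: "orientation (line_graph G) L" and uv: "(u, v) \<in> parcs G"
  shows "boundary (coboundary L (frag_of {u, v})) =
    (\<Sum>w\<in>parcs G `` {u}. frag_of {u, v} - frag_of {u, w}) +
    (\<Sum>w\<in>parcs G `` {v}. frag_of {u, v} - frag_of {v, w})"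
proof -
  interpret G: pair_graph G by fact
  have finE: "finite (edges G)" unfolding edges_def using G.pair_finite_arcs by auto
  have fin: "finite (parcs G `` {a})" for a using G.pair_finite_arcs by (rule finite_Image)
  have "parcs (line_graph G) \<subseteq> edges G \<times> edges G" unfolding line_graph_def by auto
  then have "finite (parcs (line_graph G))" using finE finite_subset by blast
  then have "boundary (coboundary L (frag_of {u, v})) =
    (\<Sum>f\<in>parcs (line_graph G) `` {{u, v}}. frag_of {u, v} - frag_of f)"
    by (rule boundary_coboundary_frag_of) (use L in \<open>auto simp: line_graph_def\<close>)
  also have "parcs (line_graph G) `` {{u, v}} =
    (\<lambda>w. {u, w}) ` (parcs G `` {u} - {v}) \<union> (\<lambda>w. {v, w}) ` (parcs G `` {v} - {u})" (is "?N = ?U \<union> ?V")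
  proof
    show "?N \<subseteq> ?U \<union> ?V"
    proof
      fix f assume "f \<in> ?N"
      then have f: "f \<in> edges G" "f \<noteq> {u, v}" "u \<in> f \<or> v \<in> f" unfolding line_graph_def by auto
      then obtain a b where ab: "f = {a, b}" "(a, b) \<in> parcs G" "(b, a) \<in> parcs G"
        using G.arcs_symmetric unfolding edges_def by auto
      then show "f \<in> ?U \<union> ?V" using f(2,3) by (auto simp: image_iff doubleton_eq_iff)
    qed
    have "{u, v} \<in> edges G" using uv by (simp add: doubleton_mem_edges_iff)
    then show "?U \<union> ?V \<subseteq> ?N" using uv G.no_loops' unfolding line_graph_def
      by (auto simp: doubleton_mem_edges_iff doubleton_eq_iff)
  qed
  \<comment> \<open>As there are no loops, only \<open>{u, v}\<close> passes through both ends, and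
    it has been left out of both families.\<close>
  also have "(\<Sum>f\<in>?U \<union> ?V. frag_of {u, v} - frag_of f) =
     (\<Sum>f\<in>?U. frag_of {u, v} - frag_of f) + (\<Sum>f\<in>?V. frag_of {u, v} - frag_of f)"
    using fin G.no_loops' uv by (intro sum.union_disjoint) (auto simp: doubleton_eq_iff)
  also have "(\<Sum>f\<in>?U. frag_of {u, v} - frag_of f) = (\<Sum>w\<in>parcs G `` {u} - {v}. frag_of {u, v} - frag_of {u, w})"
    by (subst sum.reindex) (auto simp: inj_on_def doubleton_eq_iff)
  also have "\<dots> = (\<Sum>w\<in>parcs G `` {u}. frag_of {u, v} - frag_of {u, w})"
    using fin by (intro sum.mono_neutral_left) auto
  also have "(\<Sum>f\<in>?V. frag_of {u, v} - frag_of f) = (\<Sum>w\<in>parcs G `` {v} - {u}. frag_of {u, v} - frag_of {v, w})"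
    by (subst sum.reindex) (auto simp: inj_on_def doubleton_eq_iff)
  also have "\<dots> = (\<Sum>w\<in>parcs G `` {v}. frag_of {u, v} - frag_of {v, w})"
    using fin by (intro sum.mono_neutral_left) (auto simp: insert_commute)
  finally show ?thesis .
qed

section \<open>Generators from the chords and the root\<close>

theorem theorem1p1:
  fixes G D :: "'a pair_pre_digraph" and L :: "'a set pair_pre_digraph"
  assumes "pair_graph G"
    and "two_edge_connected G"
    and "orientation G D"
    and "orientation (line_graph G) L"
  shows "\<exists>S. S \<subseteq> carrier (critical_group L) \<and> finite S \<and> card S \<le> \<beta> D \<and>
    generate (critical_group L) S = carrier (critical_group L)"
proof -
  interpret G: pair_graph G by fact
  have L_arcs: "parcs L \<subseteq> edges G \<times> edges G" and L_verts: "pverts L = edges G"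
    using assms(4) unfolding orientation_def line_graph_def by auto
  have GV: "parcs G \<subseteq> pverts G \<times> pverts G" using G.in_arcsD1 G.in_arcsD2 by auto
  show ?thesis
  \<comment> \<open>Without edges there is no chord to serve as base point, but then the critical
    group is trivial and needs no generators.\<close>
  proof (cases "edges G = {}")
    case True
    then have "parcs L = {}" using L_arcs by auto
    then have "generate (critical_group L) {} = carrier (critical_group L)"
      using critical_group_generated(2)[of "{}" L] by simp
    then show ?thesis by (intro exI[of _ "{}"]) auto
  next
    case False
    then obtain r r' where r: "(r, r') \<in> parcs G" unfolding edges_def by auto
    then have rV: "r \<in> pverts G" "r' \<in> pverts G" "r \<noteq> r'" using GV G.no_loops' by auto
    then have "card (pverts G) \<noteq> 1" by (auto simp: card_1_singleton_iff)
    interpret R: finite_sym_rel "parcs G" by (rule seeded_two_edge_connected(1)[OF assms(1,2) rV(1)])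
    have S: "R.seeded (pverts G) {r} r" by (rule seeded_two_edge_connected(2)[OF assms(1,2) rV(1)])
    obtain T where T: "R.forcing_tree (pverts G) r T"
      and forced: "\<And>(N :: ('a set \<Rightarrow>\<^sub>0 int) set) x. int_subspace N \<Longrightarrow> R.propagates N x \<Longrightarrow> R.forced (pverts G) {r} r T N x"
      using R.forcing_tree_exists[OF S] by blast
    have finE: "finite (edges G)" unfolding edges_def using G.pair_finite_arcs by auto
    \<comment> \<open>The base point is chosen among the chords, so that subtracting it saves one
      chord generator.\<close>
    obtain a b where ab: "(a, b) \<in> parcs G" "{a, b} \<notin> T"
      using R.forced_imp_chord[OF S \<open>card (pverts G) \<noteq> 1\<close> GV forced] by blast
    define c where "c = {a, b}"
    have c: "c \<in> edges G - T" using ab by (simp add: c_def doubleton_mem_edges_iff)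
    let ?R = "{(e, f). (e, f) \<in> parcs L \<or> (f, e) \<in> parcs L}"
    have adj: "(e, f) \<in> ?R\<^sup>=" if "e \<in> edges G" "f \<in> edges G" "u \<in> e" "u \<in> f" for e f u
    proof (cases "e = f")
      case False
      then have "(e, f) \<in> parcs (line_graph G)" using that unfolding line_graph_def by auto
      then show ?thesis using assms(4) unfolding orientation_def by blast
    qed simp
    \<comment> \<open>Connectedness of the line graph: the vertices all of whose edges can be
      reached from \<open>c\<close> form a closed set containing \<open>a\<close>.\<close>
    define W where "W = {u \<in> pverts G. \<forall>e\<in>edges G. u \<in> e \<longrightarrow> (c, e) \<in> ?R\<^sup>*}"
    have step: "(c, f) \<in> ?R\<^sup>*" if "(c, e) \<in> ?R\<^sup>*" "(e, f) \<in> ?R\<^sup>=" for e f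
      using that by (auto intro: rtrancl_into_rtrancl)
    have "W = pverts G"
    proof (rule R.seeded_closed[OF S])
      show "W \<subseteq> pverts G" unfolding W_def by auto
      have "a \<in> W" unfolding W_def using ab(1) GV c step[OF rtrancl_refl adj[of c]] by (auto simp: c_def)
      then show "W \<noteq> {}" by blast
      fix u v assume "u \<in> W" "v \<in> pverts G" "(u, v) \<in> parcs G"
      moreover from this have "(c, {u, v}) \<in> ?R\<^sup>*" "{u, v} \<in> edges G" unfolding W_def by (auto simp: doubleton_mem_edges_iff)
      ultimately show "v \<in> W" unfolding W_def using step adj[of "{u, v}" _ v] by auto
    qed
    have path: "(c, e) \<in> ?R\<^sup>*" if e: "e \<in> edges G" for e
    proof -
      obtain u v where "e = {u, v}" "(u, v) \<in> parcs G" using e unfolding edges_def by auto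
      then have "u \<in> W" "u \<in> e" using GV \<open>W = pverts G\<close> by auto
      then show ?thesis using e unfolding W_def by blast
    qed
    have "\<forall>e\<in>edges G. \<exists>t. Poly_Mapping.keys t \<subseteq> parcs L \<and> boundary t = frag_of e - frag_of c"
      using chain_of_path[OF path] by blast
    \<comment> \<open>The chain \<open>g e\<close> lifts \<open>e - c\<close> along the boundary
      map.\<close>
    from bchoice[OF this] obtain g where g:
      "\<forall>e\<in>edges G. Poly_Mapping.keys (g e) \<subseteq> parcs L \<and> boundary (g e) = frag_of e - frag_of c" ..
    define x where "x = (\<lambda>e. frag_of e - frag_of c)"
    \<comment> \<open>The lift of \<open>s(r) - d(r) c\<close>.\<close>
    define g0 where "g0 = (\<Sum>v\<in>parcs G `` {r}. g {r, v})"
    have g0: "Poly_Mapping.keys g0 \<subseteq> parcs L" "boundary g0 = R.star_sum x r"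
    proof -
      have e: "{r, v} \<in> edges G" if "v \<in> parcs G `` {r}" for v using that by (auto simp: doubleton_mem_edges_iff)
      show "Poly_Mapping.keys g0 \<subseteq> parcs L" unfolding g0_def
        using keys_sum[of "\<lambda>v. g {r, v}" "parcs G `` {r}"] g e by fastforce
      show "boundary g0 = R.star_sum x r" unfolding g0_def R.star_sum_def x_def
        using R.finite_nbrs g e by (simp add: boundary_sum)
    qed
    let ?F = "edges G - T"
    let ?Gs = "insert g0 (g ` (?F - {c}))"
    let ?q = "\<lambda>h. (bond_lattice L <#>\<^bsub>edge_group L\<^esub> cycle_lattice L) #>\<^bsub>edge_group L\<^esub> h"
    have keys: "Poly_Mapping.keys h \<subseteq> parcs L" if "h \<in> ?Gs" for h using that g0 g by auto
    have test: "boundary (frag_of p) \<in> N"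
      if N: "int_subspace N" and lap: "\<And>e. e \<in> pverts L \<Longrightarrow> boundary (coboundary L (frag_of e)) \<in> N"
        and gs: "\<And>h. h \<in> ?Gs \<Longrightarrow> boundary h \<in> N" and p: "p \<in> parcs L" for N p
    proof -
      have "R.propagates N x" unfolding R.propagates_def
      proof (intro allI impI)
        fix u v assume uv: "(u, v) \<in> parcs G" and xe: "x {u, v} \<in> N" and su: "R.star_sum x u \<in> N"
        \<comment> \<open>Multiples of a label are written as constant sums, so that closure under
          sums covers them.\<close>
        have xsum: "(\<Sum>w\<in>A. x {u, v}) \<in> N" for A :: "'a set" by (rule int_subspace_sum[OF N xe])
        \<comment> \<open>Every summand is a difference of two edges, so \<open>c\<close> cancels
          and \<open>frag_of\<close> may be replaced by \<open>x\<close>.\<close>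
        have "boundary (coboundary L (frag_of {u, v})) =
          (\<Sum>w\<in>parcs G `` {u}. x {u, v}) - R.star_sum x u + ((\<Sum>w\<in>parcs G `` {v}. x {u, v}) - R.star_sum x v)"
          unfolding boundary_coboundary_line_graph[OF assms(1,4) uv] R.star_sum_def sum_subtractf[symmetric]
          by (simp add: x_def)
        then have "R.star_sum x v = (\<Sum>w\<in>parcs G `` {u}. x {u, v}) - R.star_sum x u +
          (\<Sum>w\<in>parcs G `` {v}. x {u, v}) - boundary (coboundary L (frag_of {u, v}))"
          by (simp add: algebra_simps)
        moreover have "boundary (coboundary L (frag_of {u, v})) \<in> N"
          using lap uv L_verts by (simp add: doubleton_mem_edges_iff)
        ultimately show "R.star_sum x v \<in> N"
          using su xsum by (simp only:) (intro int_subspace_diff[OF N] int_subspace_add[OF N])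
      qed
      then have F: "R.forced (pverts G) {r} r T N x" by (rule forced[OF N])
      have chord: "x {u, v} \<in> N" if "(u, v) \<in> parcs G" "{u, v} \<notin> T" for u v
      \<comment> \<open>The label \<open>x c\<close> is zero, and every other chord has a generator
        of its own.\<close>
      proof (cases "{u, v} = c")
        case True
        then show ?thesis using N unfolding x_def int_subspace_def by simp
      next
        case False
        have e: "{u, v} \<in> edges G" using that by (simp add: doubleton_mem_edges_iff)
        then have "boundary (g {u, v}) \<in> N" using that False by (intro gs) auto
        then show ?thesis using g e unfolding x_def by simp
      qed
      have seed: "R.star_sum x r \<in> N" using gs[of g0] unfolding g0(2) by simp
      have "x {u, v} \<in> N" if "(u, v) \<in> parcs G" for u v
        by (rule R.forcedD(1)[OF F]) (use that chord seed GV in auto)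
      then have xN: "x e \<in> N" if "e \<in> edges G" for e using that unfolding edges_def by auto
      \<comment> \<open>The boundary of an arc is a difference of two edges, in which
        \<open>c\<close> cancels again.\<close>
      obtain e f where ef: "p = (e, f)" "e \<in> edges G" "f \<in> edges G" using p L_arcs by auto
      then have "x f - x e \<in> N" using xN int_subspace_diff[OF N] by blast
      then show ?thesis unfolding ef(1) boundary_frag_of x_def by simp
    qed
    have gen: "?q ` ?Gs \<subseteq> carrier (critical_group L)"
      "generate (critical_group L) (?q ` ?Gs) = carrier (critical_group L)"
      by (rule critical_group_generated; fact keys test)+
    have "card (?q ` ?Gs) \<le> card ?Gs" using finE by (intro card_image_le) auto
    \<comment> \<open>The generator from \<open>g0\<close> takes the place saved at
      \<open>c\<close>, so the total does not exceed the number of chords.\<close>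
    moreover have "card ?Gs \<le> Suc (card (g ` (?F - {c})))"
      using finE by (simp add: card_insert_if)
    moreover have "card (g ` (?F - {c})) \<le> card (?F - {c})"
      using finE by (intro card_image_le) simp
    moreover have "Suc (card (?F - {c})) = card ?F" using finE c by (intro card_Suc_Diff1) auto
    moreover have "card ?F \<le> \<beta> D"
      by (rule card_chords_le_num_independent_cycles[OF R.finite_sym_rel_axioms assms(3) GV T])
    ultimately have "card (?q ` ?Gs) \<le> \<beta> D" by linarith
    moreover have "finite (?q ` ?Gs)" using finE by simp
    ultimately show ?thesis using gen by (intro exI[of _ "?q ` ?Gs"] conjI)
  qed
qed

end
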